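(* Let $n$ and $r$ be integers with $2\leq n\leq 5$ and $r\geq n$. Then the Vietoris--Rips complex $\mathrm{VR}(\mathbb{Z}^n;r)$ is contractible.
   Context: $\mathbb{Z}^n$ is equipped with the Manhattan (word) metric $d(x,y)=\sum_{i=1}^n |x_i-y_i|$. For a metric space $X$ and $r\geq 0$, $\mathrm{VR}(X;r)$ is the simplicial complex with vertex set $X$ whose simplices are the finite subsets of $X$ of diameter at most $r$. *)

theory Defs
  imports "HOL-Analysis.Analysis"
begin

definition manhattan :: "int ^ 'n::finite \<Rightarrow> int ^ 'n \<Rightarrow> int" where
  "manhattan x y = (\<Sum>i\<in>UNIV. \<bar>x $ i - y $ i\<bar>)"

definition VR_simplices :: "'a set \<Rightarrow> ('a \<Rightarrow> 'a \<Rightarrow> 'b::linorder) \<Rightarrow> 'b \<Rightarrow> 'a set set" where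
  "VR_simplices X d r =
     {\<sigma>. \<sigma> \<subseteq> X \<and> finite \<sigma> \<and> \<sigma> \<noteq> {} \<and> (\<forall>x\<in>\<sigma>. \<forall>y\<in>\<sigma>. d x y \<le> r)}"

text \<open>Geometric simplex spanned by a finite vertex set, as barycentric coordinate functions.\<close>
definition simplex_set :: "'a set \<Rightarrow> ('a \<Rightarrow> real) set" where
  "simplex_set \<sigma> = {f. (\<forall>x. 0 \<le> f x) \<and> (\<forall>x. x \<notin> \<sigma> \<longrightarrow> f x = 0) \<and> sum f \<sigma> = 1}"

definition realization_carrier :: "'a set set \<Rightarrow> ('a \<Rightarrow> real) set" where
  "realization_carrier K = \<Union> (simplex_set ` K)"

text \<open>Geometric realization with the weak (coherent) topology: a set is open iff its
  intersection with every closed geometric simplex is open in that simplex (each finite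
  simplex carries the Euclidean topology, induced from the product topology).\<close>
definition realization_open :: "'a set set \<Rightarrow> ('a \<Rightarrow> real) set \<Rightarrow> bool" where
  "realization_open K U \<longleftrightarrow> U \<subseteq> realization_carrier K \<and>
     (\<forall>\<sigma>\<in>K. openin (top_of_set (simplex_set \<sigma>)) (U \<inter> simplex_set \<sigma>))"

lemma istopology_realization_open: "istopology (realization_open K)"
  unfolding istopology_def
proof (intro conjI allI impI)
  fix S T assume S: "realization_open K S" and T: "realization_open K T"
  show "realization_open K (S \<inter> T)"
    unfolding realization_open_def
  proof (intro conjI ballI)
    show "S \<inter> T \<subseteq> realization_carrier K" using S unfolding realization_open_def by blast
    fix \<sigma> assume "\<sigma> \<in> K"
    then have "openin (top_of_set (simplex_set \<sigma>)) ((S \<inter> simplex_set \<sigma>) \<inter> (T \<inter> simplex_set \<sigma>))"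
      using S T unfolding realization_open_def by (metis openin_Int)
    then show "openin (top_of_set (simplex_set \<sigma>)) (S \<inter> T \<inter> simplex_set \<sigma>)"
      by (simp add: Int_ac)
  qed
next
  fix \<K> assume A: "\<forall>U\<in>\<K>. realization_open K U"
  show "realization_open K (\<Union>\<K>)"
    unfolding realization_open_def
  proof (intro conjI ballI)
    show "\<Union>\<K> \<subseteq> realization_carrier K" using A unfolding realization_open_def by blast
    fix \<sigma> assume "\<sigma> \<in> K"
    then have "openin (top_of_set (simplex_set \<sigma>)) (\<Union>U\<in>\<K>. U \<inter> simplex_set \<sigma>)"
      using A unfolding realization_open_def by (intro openin_Union) auto
    moreover have "(\<Union>U\<in>\<K>. U \<inter> simplex_set \<sigma>) = \<Union>\<K> \<inter> simplex_set \<sigma>" by blast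
    ultimately show "openin (top_of_set (simplex_set \<sigma>)) (\<Union>\<K> \<inter> simplex_set \<sigma>)" by simp
  qed
qed

definition realization :: "'a set set \<Rightarrow> ('a \<Rightarrow> real) topology" where
  "realization K = topology (realization_open K)"

lemma openin_realization: "openin (realization K) = realization_open K"
  unfolding realization_def using istopology_realization_open by (simp add: topology_inverse_iff)

end

theory Submission
  imports Defs
begin

text \<open>
  Boxes exhaust \<open>\<int>\<^sup>n\<close>, and the Rips complex of a box is built by adding its vertices in lexicographic order.
  A vertex \<open>v\<close> attaches a cone over the Rips complex of its lower neighbours. That link is a union of
  vertex stars of a clique \<open>Y\<close> of lattice points slightly below \<open>v\<close>, so all intersections of these stars
  are cones. What makes this work is that every clique of lower neighbours lies within distance \<open>r\<close>
  of some \<open>y = v - \<delta>\<close> in \<open>Y\<close>: two differences \<open>v - z\<close> of length close to \<open>r\<close> must overlap in some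
  signed coordinate, and for \<open>n \<le> 5\<close> one, two or three signed coordinates can be chosen
  that meet all of them often enough.

  Contractibility of the pieces is handled through the extension property for maps from closed
  subsets of a metric space. It is inherited by a union of two closed sets from the sets and their
  intersection, and it extends a contraction from one box complex to the next, which
  gives a contraction of the whole complex.
\<close>

section \<open>Absolute extensors\<close>

text \<open>Let \<delta> have k entries 1 or -1 and zeros elsewhere. Passing from v to v - \<delta>
  changes the length of a difference w = v - z by at most k, with the parity of k. So for k = 1, 2,
  3 only the w of length at least r, r - 1, r - 2 are endangered, and these must agree in sign with
  \<delta> often enough. Other demands compete: v - \<delta> has to precede v, so the first nonzero
  entry of \<delta> is positive; it has to stay in the box; and the candidates for \<delta> have to
  be pairwise within distance r, which \<open>2 * len \<delta> \<le> r\<close> ensures. Two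
  coordinates are thus affordable from r = 4 on and three only from r = 6 on, which makes r = 5
  delicate. The assumption that r is at least n enters as the vanishing of all coordinates with
  index at least r; it is decisive for r \<le> 4. On the topological side, finite subcomplexes are
  closed subsets of the space of coordinate functions, and the extension property is used there. The
  weak topology matters only when the finite stages are glued, and local finiteness reduces it to
  them.\<close>

text \<open>The test space is a type argument because a definition cannot quantify over all metric
  spaces. The instance needed in the end is \<open>real \<times> ('a \<Rightarrow> real)\<close>,
  the domain of a homotopy.\<close>

definition extensor :: "'x::metric_space itself \<Rightarrow> 'b::topological_space set \<Rightarrow> bool" where
  "extensor _ S \<longleftrightarrow> (\<forall>(C::'x set) f. closed C \<longrightarrow> continuous_on C f \<longrightarrow> f ` C \<subseteq> S \<longrightarrow>
     (\<exists>g. continuous_on UNIV g \<and> range g \<subseteq> S \<and> (\<forall>x\<in>C. g x = f x)))"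

lemma extensorE:
  fixes C :: "'x::metric_space set"
  assumes "extensor TYPE('x) S" "closed C" "continuous_on C f" "f ` C \<subseteq> S"
  obtains g where "continuous_on UNIV g" "range g \<subseteq> S" "\<And>x. x \<in> C \<Longrightarrow> g x = f x"
proof -
  have "\<exists>g. continuous_on UNIV g \<and> range g \<subseteq> S \<and> (\<forall>x\<in>C. g x = f x)"
    using assms(1)[unfolded extensor_def, rule_format, OF assms(2-4)] .
  then show thesis using that by blast
qed

text \<open>The domain is cut into the points nearer to the part of \<open>C\<close> sent into
  \<open>S\<close> and those nearer to the part sent into \<open>T\<close>. On the equidistant set
  the map is first extended into \<open>S \<inter> T\<close>; then each half is extended separately,
  and the two extensions match there by construction.\<close>

lemma extensor_Un:
  fixes S T :: "'b::topological_space set"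
  assumes S: "closed S" "extensor TYPE('x::metric_space) S"
    and T: "closed T" "extensor TYPE('x) T"
    and ST: "extensor TYPE('x) (S \<inter> T)"
  shows "extensor TYPE('x) (S \<union> T)"
  unfolding extensor_def
proof (intro allI impI)
  fix C :: "'x set" and f :: "'x \<Rightarrow> 'b"
  assume C: "closed C" and f: "continuous_on C f" and im: "f ` C \<subseteq> S \<union> T"
  define CS where "CS = C \<inter> f -` S"
  define CT where "CT = C \<inter> f -` T"
  have cl: "closed CS" "closed CT"
    unfolding CS_def CT_def using C f S(1) T(1) by (blast intro: continuous_closed_preimage)+
  have Ceq: "C = CS \<union> CT" using im by (auto simp: CS_def CT_def)
  \<comment> \<open>\<open>infdist\<close> to the empty set is 0 by convention, so comparing
    distances makes sense only when both parts are nonempty.\<close>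
  consider "CT = {}" | "CS = {}" | "CS \<noteq> {}" "CT \<noteq> {}" by blast
  then show "\<exists>g. continuous_on UNIV g \<and> range g \<subseteq> S \<union> T \<and> (\<forall>x\<in>C. g x = f x)"
  proof cases
    case 1
    then have fS: "f ` C \<subseteq> S" using im by (auto simp: CT_def)
    show ?thesis by (rule extensorE[OF S(2) C f fS]) blast
  next
    case 2
    then have fT: "f ` C \<subseteq> T" using im by (auto simp: CS_def)
    show ?thesis by (rule extensorE[OF T(2) C f fT]) blast
  next
    case 3
    define XS where "XS = {x. infdist x CS \<le> infdist x CT}"
    define XT where "XT = {x. infdist x CT \<le> infdist x CS}"
    have clX: "closed XS" "closed XT"
      unfolding XS_def XT_def
      by (simp_all add: closed_Collect_le continuous_on_infdist)
    have zero: "x \<in> CS \<longleftrightarrow> infdist x CS = 0" "x \<in> CT \<longleftrightarrow> infdist x CT = 0" for x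
      using 3 cl in_closed_iff_infdist_zero by blast+
    \<comment> \<open>A point of \<open>C\<close> has distance 0 from one of the two parts, so being
      nearer to \<open>CS\<close> forces distance 0 from \<open>CS\<close>.\<close>
    have "x \<in> XS \<inter> C \<longleftrightarrow> x \<in> CS" "x \<in> XT \<inter> C \<longleftrightarrow> x \<in> CT" for x
      unfolding Ceq XS_def XT_def Int_iff Un_iff mem_Collect_eq zero
      using infdist_nonneg[of x CS] infdist_nonneg[of x CT] by linarith+
    then have XC: "XS \<inter> C = CS" "XT \<inter> C = CT" by blast+
    have sub': "CS \<subseteq> C" "CT \<subseteq> C" using Ceq by blast+
    have sub: "CS \<subseteq> XS" "CT \<subseteq> XT" using XC by blast+
    define X0 where "X0 = XS \<inter> XT"
    have X0C: "X0 \<inter> C = CS \<inter> CT" unfolding X0_def using XC by blast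
    have clX0: "closed X0" using clX by (auto simp: X0_def)
    have 1: "closed (CS \<inter> CT)" using cl by auto
    have 2: "continuous_on (CS \<inter> CT) f"
      using f by (rule continuous_on_subset) (auto simp: CS_def)
    have 3: "f ` (CS \<inter> CT) \<subseteq> S \<inter> T" by (auto simp: CS_def CT_def)
    obtain g0 where g0: "continuous_on UNIV g0" "range g0 \<subseteq> S \<inter> T"
        "\<And>x. x \<in> CS \<inter> CT \<Longrightarrow> g0 x = f x"
      using extensorE[OF ST 1 2 3] by blast
    have cont: "continuous_on (D \<union> X0) (\<lambda>x. if x \<in> D then f x else g0 x)"
      if D: "closed D" "D \<subseteq> C" "X0 \<inter> D \<subseteq> CS \<inter> CT" for D
    proof (rule continuous_on_cases)
      show "continuous_on D f" using f D(2) by (rule continuous_on_subset)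
      show "continuous_on X0 g0" using g0(1) by (rule continuous_on_subset) simp
      show "\<forall>x. x \<in> D \<and> x \<notin> D \<or> x \<in> X0 \<and> x \<in> D \<longrightarrow> f x = g0 x"
        using g0(3) D(3) by fastforce
    qed (use D clX0 clX in blast)+
    have S0: "(\<lambda>x. if x \<in> CS then f x else g0 x) ` (CS \<union> X0) \<subseteq> S"
      using g0(2) by (auto simp: CS_def)
    have T0: "(\<lambda>x. if x \<in> CT then f x else g0 x) ` (CT \<union> X0) \<subseteq> T"
      using g0(2) by (auto simp: CT_def)
    have cS: "continuous_on (CS \<union> X0) (\<lambda>x. if x \<in> CS then f x else g0 x)"
      using cl sub' X0C by (intro cont) blast+
    have cT: "continuous_on (CT \<union> X0) (\<lambda>x. if x \<in> CT then f x else g0 x)"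
      using cl sub' X0C by (intro cont) blast+
    obtain gS where gS: "continuous_on UNIV gS" "range gS \<subseteq> S"
        "\<And>x. x \<in> CS \<union> X0 \<Longrightarrow> gS x = (if x \<in> CS then f x else g0 x)"
      using extensorE[OF S(2) closed_Un[OF cl(1) clX0] cS S0] by blast
    obtain gT where gT: "continuous_on UNIV gT" "range gT \<subseteq> T"
        "\<And>x. x \<in> CT \<union> X0 \<Longrightarrow> gT x = (if x \<in> CT then f x else g0 x)"
      using extensorE[OF T(2) closed_Un[OF cl(2) clX0] cT T0] by blast
    have agree: "gS x = gT x" if "x \<in> X0" for x
    proof (cases "x \<in> C")
      case True
      then have "x \<in> CS \<inter> CT" using X0C that by blast
      then show ?thesis using gS(3)[of x] gT(3)[of x] by simp
    next
      case False
      then have "x \<notin> CS" "x \<notin> CT" using sub' by blast+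
      then show ?thesis using gS(3)[of x] gT(3)[of x] that by simp
    qed
    have UN: "XS \<union> XT = UNIV" by (auto simp: XS_def XT_def)
    have "continuous_on (XS \<union> XT) (\<lambda>x. if x \<in> XS then gS x else gT x)"
    proof (rule continuous_on_cases)
      show "continuous_on XS gS" using gS(1) by (rule continuous_on_subset) simp
      show "continuous_on XT gT" using gT(1) by (rule continuous_on_subset) simp
      show "\<forall>x. x \<in> XS \<and> x \<notin> XS \<or> x \<in> XT \<and> x \<in> XS \<longrightarrow> gS x = gT x"
        using agree by (auto simp: X0_def)
    qed (use clX in blast)+
    moreover have "(if x \<in> XS then gS x else gT x) = f x" if "x \<in> C" for x
    proof (cases "x \<in> XS")
      case True
      then have "x \<in> CS" using XC that by blast
      then show ?thesis using True gS(3)[of x] by auto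
    next
      case False
      then have "x \<in> CT" using XC that UN by blast
      then show ?thesis using False gT(3)[of x] by auto
    qed
    moreover have "range (\<lambda>x. if x \<in> XS then gS x else gT x) \<subseteq> S \<union> T"
      using gS(2) gT(2) by auto
    ultimately show ?thesis unfolding UN by blast
  qed
qed

text \<open>Induction through \<open>extensor_Un\<close>: \<open>A i\<close> meets the union of the
  others in the union of the sets \<open>A i \<inter> A j\<close>, whose intersections are again
  intersections of members of the family. This is why \<open>A\<close> is generalised.\<close>

lemma extensor_Union:
  fixes A :: "'i \<Rightarrow> 'b::topological_space set"
  assumes "finite I" "I \<noteq> {}"
    and "\<And>i. i \<in> I \<Longrightarrow> closed (A i)"
    and "\<And>J. J \<subseteq> I \<Longrightarrow> J \<noteq> {} \<Longrightarrow> extensor TYPE('x::metric_space) (\<Inter>j\<in>J. A j)"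
  shows "extensor TYPE('x) (\<Union>i\<in>I. A i)"
  using assms
proof (induction I arbitrary: A rule: finite_ne_induct)
  case (singleton i)
  then show ?case by force
next
  case (insert i I)
  have 1: "extensor TYPE('x) (\<Union>j\<in>I. A j)"
    by (rule insert.IH) (use insert.prems in auto)
  have 2: "extensor TYPE('x) (\<Union>j\<in>I. A i \<inter> A j)"
  proof (rule insert.IH)
    fix J assume "J \<subseteq> I" "J \<noteq> {}"
    then have "extensor TYPE('x) (\<Inter>j\<in>insert i J. A j)"
      by (intro insert.prems(2)) auto
    moreover have "(\<Inter>j\<in>insert i J. A j) = (\<Inter>j\<in>J. A i \<inter> A j)"
      using \<open>J \<noteq> {}\<close> by auto
    ultimately show "extensor TYPE('x) (\<Inter>j\<in>J. A i \<inter> A j)" by simp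
  qed (use insert.prems in auto)
  have 3: "extensor TYPE('x) (A i)"
    using insert.prems(2)[of "{i}"] by auto
  have "extensor TYPE('x) (A i \<union> (\<Union>j\<in>I. A j))"
  proof (rule extensor_Un)
    show "closed (A i)" "closed (\<Union>j\<in>I. A j)"
      using insert.prems(1) insert.hyps(1) by (auto intro: closed_UN)
    show "extensor TYPE('x) (A i \<inter> (\<Union>j\<in>I. A j))"
      using 2 by (simp only: Int_UN_distrib)
  qed (use 1 3 in auto)
  then show ?case by simp
qed

section \<open>Closed simplices as extensors\<close>

lemma closed_simplex_set: "closed (simplex_set \<sigma>)"
proof -
  have "simplex_set \<sigma> = (\<Inter>x. {f. 0 \<le> f x}) \<inter> (\<Inter>x\<in>-\<sigma>. {f. f x = 0}) \<inter> {f. (\<Sum>x\<in>\<sigma>. f x) = 1}"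
    unfolding simplex_set_def by blast
  moreover have "closed {f::'a \<Rightarrow> real. 0 \<le> f x}" "closed {f::'a \<Rightarrow> real. f x = 0}" for x
    by (intro closed_Collect_le closed_Collect_eq continuous_on_const continuous_on_product_coordinates)+
  moreover have "closed {f::'a \<Rightarrow> real. (\<Sum>x\<in>\<sigma>. f x) = 1}"
    by (intro closed_Collect_eq continuous_on_const continuous_on_sum continuous_on_product_coordinates)
  ultimately show ?thesis by (metis closed_INT closed_Int)
qed

text \<open>Dugundji's theorem is applied to each barycentric coordinate separately, with values in
  the half-line; the coordinate sum 1 is lost off \<open>C\<close> and has to be restored.\<close>

lemma extensor_simplex_set:
  fixes \<sigma> :: "'a set"
  assumes fin: "finite \<sigma>" and ne: "\<sigma> \<noteq> {}"
  shows "extensor TYPE('x::{metric_space,second_countable_topology}) (simplex_set \<sigma>)"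
  unfolding extensor_def
proof (intro allI impI)
  fix C :: "'x set" and f :: "'x \<Rightarrow> 'a \<Rightarrow> real"
  assume C: "closed C" and f: "continuous_on C f" and im: "f ` C \<subseteq> simplex_set \<sigma>"
  obtain v where v: "v \<in> \<sigma>" using ne by auto
  have "\<exists>g. continuous_on UNIV g \<and> (\<forall>x\<in>C. g x = f x a) \<and> (\<forall>x. 0 \<le> g x)" if "a \<in> \<sigma>" for a
  proof -
    have 1: "closedin (top_of_set UNIV) C" using C by simp
    have 2: "continuous_on C (\<lambda>x. f x a)"
      using f by (rule continuous_on_product_then_coordinatewise)
    have 3: "(\<lambda>x. f x a) ` C \<subseteq> {0..}" using im by (auto simp: simplex_set_def)
    have 4: "convex {0::real..}" "{0::real..} \<noteq> {}" by auto
    obtain g where "continuous_on UNIV g" "g ` UNIV \<subseteq> {0..}" "\<And>x. x \<in> C \<Longrightarrow> g x = f x a"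
      using Dugundji[OF 4 1 2 3] by blast
    then show ?thesis by (intro exI[of _ g]) auto
  qed
  then obtain g where g: "\<And>a. a \<in> \<sigma> \<Longrightarrow> continuous_on UNIV (g a)"
      "\<And>a x. a \<in> \<sigma> \<Longrightarrow> x \<in> C \<Longrightarrow> g a x = f x a" "\<And>a x. a \<in> \<sigma> \<Longrightarrow> 0 \<le> g a x"
    by metis
  text \<open>Topping up one coordinate makes the coordinate sum at least 1, so it can be normalised.\<close>
  define s where "s = (\<lambda>x. \<Sum>a\<in>\<sigma>. g a x)"
  define h where "h = (\<lambda>x a. if a \<in> \<sigma> then
     (g a x + (if a = v then max 0 (1 - s x) else 0)) / max 1 (s x) else 0)"
  have cs: "continuous_on UNIV s"
    unfolding s_def by (intro continuous_intros g(1))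
  have "continuous_on UNIV (\<lambda>x. h x a)" for a
    using g(1)[of a] cs unfolding h_def
    by (cases "a \<in> \<sigma>"; cases "a = v"; simp) (intro continuous_intros; force)+
  then have "continuous_on UNIV h"
    by (rule continuous_on_coordinatewise_then_product)
  moreover have "h x \<in> simplex_set \<sigma>" for x
  proof -
    have "(\<Sum>a\<in>\<sigma>. h x a) = (\<Sum>a\<in>\<sigma>. g a x + (if a = v then max 0 (1 - s x) else 0)) / max 1 (s x)"
      unfolding sum_divide_distrib by (rule sum.cong) (auto simp: h_def)
    also have "\<dots> = (s x + max 0 (1 - s x)) / max 1 (s x)"
      using fin v by (simp add: sum.distrib s_def)
    also have "\<dots> = 1" by (simp add: max_def)
    finally show ?thesis
      using g(3) by (auto simp: simplex_set_def h_def)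
  qed
  moreover have "h x = f x" if "x \<in> C" for x
  proof
    fix a
    have "s x = (\<Sum>a\<in>\<sigma>. f x a)"
      unfolding s_def using g(2) that by (intro sum.cong) auto
    then have "s x = 1" using im that by (auto simp: simplex_set_def)
    then show "h x a = f x a"
      using im that g(2) by (auto simp: simplex_set_def h_def)
  qed
  ultimately show "\<exists>g. continuous_on UNIV g \<and> range g \<subseteq> simplex_set \<sigma> \<and> (\<forall>x\<in>C. g x = f x)"
    by blast
qed

section \<open>Flag complexes\<close>

definition abstract_complex :: "'a set set \<Rightarrow> bool" where
  "abstract_complex K \<longleftrightarrow>
     (\<forall>\<sigma>\<in>K. finite \<sigma> \<and> \<sigma> \<noteq> {} \<and> (\<forall>\<tau>. \<tau> \<subseteq> \<sigma> \<longrightarrow> \<tau> \<noteq> {} \<longrightarrow> \<tau> \<in> K))"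

text \<open>With points described through their support, \<open>\<sigma>\<close> enters only via
  inclusion, so intersections of simplices and of realizations reduce to set theory.\<close>

lemma simplex_set_iff:
  assumes "finite \<sigma>"
  shows "f \<in> simplex_set \<sigma> \<longleftrightarrow>
    (\<forall>x. 0 \<le> f x) \<and> {x. f x \<noteq> 0} \<subseteq> \<sigma> \<and> sum f {x. f x \<noteq> 0} = 1"
proof -
  have "sum f \<sigma> = sum f {x. f x \<noteq> 0}" if "{x. f x \<noteq> 0} \<subseteq> \<sigma>"
    using assms that by (intro sum.mono_neutral_right) auto
  moreover have "{x. f x \<noteq> 0} \<subseteq> \<sigma> \<longleftrightarrow> (\<forall>x. x \<notin> \<sigma> \<longrightarrow> f x = 0)" by blast
  ultimately show ?thesis unfolding simplex_set_def mem_Collect_eq by metis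
qed

lemma realization_carrier_eq:
  assumes "abstract_complex K"
  shows "realization_carrier K =
    {f. (\<forall>x. 0 \<le> f x) \<and> {x. f x \<noteq> 0} \<in> K \<and> sum f {x. f x \<noteq> 0} = 1}" (is "_ = ?R")
proof (intro set_eqI iffI)
  fix f assume "f \<in> realization_carrier K"
  then obtain \<sigma> where \<sigma>: "\<sigma> \<in> K" "f \<in> simplex_set \<sigma>"
    unfolding realization_carrier_def by auto
  then have fin: "finite \<sigma>" using assms by (auto simp: abstract_complex_def)
  have "{x. f x \<noteq> 0} \<noteq> {}"
  proof
    assume "{x. f x \<noteq> 0} = {}"
    then show False using \<sigma>(2) unfolding simplex_set_iff[OF fin] by simp
  qed
  then show "f \<in> ?R"
    using \<sigma> assms unfolding simplex_set_iff[OF fin] abstract_complex_def by blast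
next
  fix f assume f: "f \<in> ?R"
  then have fin: "finite {x. f x \<noteq> 0}" using assms by (auto simp: abstract_complex_def)
  show "f \<in> realization_carrier K"
    unfolding realization_carrier_def
    using f simplex_set_iff[OF fin, of f] by blast
qed

lemma closed_realization_carrier: "finite K \<Longrightarrow> closed (realization_carrier K)"
  unfolding realization_carrier_def using closed_simplex_set by blast

lemma realization_carrier_mono: "K \<subseteq> L \<Longrightarrow> realization_carrier K \<subseteq> realization_carrier L"
  unfolding realization_carrier_def by blast

lemma realization_carrier_Un: "realization_carrier (K \<union> L) = realization_carrier K \<union> realization_carrier L"
  unfolding realization_carrier_def by blast

text \<open>A point has only one support, so it lies in both realizations exactly when that support
  is a simplex of both complexes.\<close>

lemma realization_carrier_Int:
  assumes "abstract_complex K" "abstract_complex L" "abstract_complex (K \<inter> L)"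
  shows "realization_carrier (K \<inter> L) = realization_carrier K \<inter> realization_carrier L"
  using assms by (auto simp: realization_carrier_eq)

text \<open>The simplices containing the apex \<open>y\<close> cover the realization, and any of
  them meet in a simplex that contains \<open>y\<close>, hence in a nonempty one;
  \<open>extensor_Union\<close> applies with these simplices as pieces.\<close>

lemma extensor_cone:
  assumes K: "abstract_complex K" "finite K" "K \<noteq> {}"
    and y: "\<And>\<sigma>. \<sigma> \<in> K \<Longrightarrow> insert y \<sigma> \<in> K"
  shows "extensor TYPE('x::{metric_space,second_countable_topology}) (realization_carrier K)"
proof -
  define I where "I = {\<sigma>\<in>K. y \<in> \<sigma>}"
  have fin: "finite \<sigma>" if "\<sigma> \<in> K" for \<sigma> using K that by (auto simp: abstract_complex_def)
  have "simplex_set \<sigma> \<subseteq> simplex_set (insert y \<sigma>)" if "\<sigma> \<in> K" for \<sigma>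
    using fin[OF that] by (auto simp: simplex_set_iff)
  then have "realization_carrier K = (\<Union>\<sigma>\<in>I. simplex_set \<sigma>)"
    unfolding realization_carrier_def I_def using y by blast
  moreover have "extensor TYPE('x) (\<Union>\<sigma>\<in>I. simplex_set \<sigma>)"
  proof (rule extensor_Union)
    show "finite I" using K by (auto simp: I_def)
    show "I \<noteq> {}" using K y by (auto simp: I_def)
    show "closed (simplex_set \<sigma>)" for \<sigma> :: "'a set" by (rule closed_simplex_set)
    fix J assume J: "J \<subseteq> I" "J \<noteq> {}"
    obtain \<sigma>0 where "\<sigma>0 \<in> J" using J(2) by blast
    then have "finite (\<Inter>J)"
      using finite_Inter[of J] fin J(1) unfolding I_def by blast
    moreover have "\<Inter>J \<noteq> {}" using J(1) unfolding I_def by blast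
    moreover have "(\<Inter>\<sigma>\<in>J. simplex_set \<sigma>) = simplex_set (\<Inter>J)"
    proof -
      have "f \<in> (\<Inter>\<sigma>\<in>J. simplex_set \<sigma>) \<longleftrightarrow> (\<forall>\<sigma>\<in>J. (\<forall>x. 0 \<le> f x) \<and> {x. f x \<noteq> 0} \<subseteq> \<sigma> \<and>
          sum f {x. f x \<noteq> 0} = 1)" for f
        unfolding INT_iff
      proof (rule ball_cong)
        fix \<sigma> assume "\<sigma> \<in> J"
        then have "finite \<sigma>" using J(1) fin by (auto simp: I_def)
        then show "f \<in> simplex_set \<sigma> \<longleftrightarrow> (\<forall>x. 0 \<le> f x) \<and> {x. f x \<noteq> 0} \<subseteq> \<sigma> \<and>
          sum f {x. f x \<noteq> 0} = 1" by (rule simplex_set_iff)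
      qed simp
      then show ?thesis
        unfolding set_eq_iff simplex_set_iff[OF \<open>finite (\<Inter>J)\<close>] le_Inf_iff
        using \<open>\<sigma>0 \<in> J\<close> by metis
    qed
    ultimately show "extensor TYPE('x) (\<Inter>\<sigma>\<in>J. simplex_set \<sigma>)"
      by (simp add: extensor_simplex_set)
  qed
  ultimately show ?thesis by simp
qed

lemma abstract_complex_VR: "abstract_complex (VR_simplices X d r)"
  unfolding abstract_complex_def VR_simplices_def by (auto intro: finite_subset)

lemma finite_VR: "finite X \<Longrightarrow> finite (VR_simplices X d r)"
  by (rule finite_subset[of _ "Pow X"]) (auto simp: VR_simplices_def)

section \<open>Rips complexes: stars, links and vertex orders\<close>

locale rips =
  fixes d :: "'a \<Rightarrow> 'a \<Rightarrow> 'b::linorder" and r :: 'b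
  assumes sym: "d x y = d y x" and self: "d x x \<le> r"
begin

abbreviation "VR X \<equiv> VR_simplices X d r"

text \<open>For a single \<open>y\<close> in \<open>X\<close> this is the closed star of
  \<open>y\<close>; for a nonempty \<open>J\<close> inside \<open>X\<close>, the intersection of the
  closed stars of its members.\<close>

definition star :: "'a set \<Rightarrow> 'a set \<Rightarrow> 'a set set" where
  "star X J = {\<sigma>\<in>VR X. \<forall>y\<in>J. \<forall>z\<in>\<sigma>. d y z \<le> r}"

lemma abstract_complex_star: "abstract_complex (star X J)"
  using abstract_complex_VR[of X d r] unfolding abstract_complex_def star_def by blast

lemma finite_star: "finite X \<Longrightarrow> finite (star X J)"
  using finite_VR[of X d r] by (simp add: star_def)

text \<open>Any member of the clique \<open>J\<close> is an apex: it is within \<open>r\<close> of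
  all of \<open>J\<close> and of every vertex of a simplex in the star.\<close>

lemma extensor_star:
  assumes "finite X" "J \<subseteq> X" "J \<noteq> {}" "\<And>x y. x \<in> J \<Longrightarrow> y \<in> J \<Longrightarrow> d x y \<le> r"
  shows "extensor TYPE('x::{metric_space,second_countable_topology}) (realization_carrier (star X J))"
proof -
  obtain y where y: "y \<in> J" using assms by auto
  then have "{y} \<in> star X J"
    using assms self by (auto simp: star_def VR_simplices_def)
  moreover have "insert y \<sigma> \<in> star X J" if "\<sigma> \<in> star X J" for \<sigma>
  proof -
    have "\<forall>z\<in>\<sigma>. d y z \<le> r \<and> d z y \<le> r" using that y by (auto simp: star_def sym[of _ y])
    then show ?thesis
      using that y assms(2,4) self unfolding star_def VR_simplices_def by auto
  qed
  ultimately show ?thesis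
    using assms(1) by (intro extensor_cone abstract_complex_star finite_star) auto
qed

lemma extensor_star_cover:
  assumes "finite X" "Y \<subseteq> X" "Y \<noteq> {}" and clique: "\<And>x y. x \<in> Y \<Longrightarrow> y \<in> Y \<Longrightarrow> d x y \<le> r"
    and cover: "\<And>\<sigma>. \<sigma> \<in> VR X \<Longrightarrow> \<exists>y\<in>Y. \<forall>z\<in>\<sigma>. d y z \<le> r"
  shows "extensor TYPE('x::{metric_space,second_countable_topology}) (realization_carrier (VR X))"
proof -
  have "VR X = (\<Union>y\<in>Y. star X {y})"
    using cover by (auto simp: star_def)
  then have "realization_carrier (VR X) = (\<Union>y\<in>Y. realization_carrier (star X {y}))"
    unfolding realization_carrier_def by blast
  moreover have "extensor TYPE('x) (\<Union>y\<in>Y. realization_carrier (star X {y}))"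
  proof (rule extensor_Union)
    show "finite Y" using assms finite_subset by blast
    show "closed (realization_carrier (star X {y}))" for y
      by (rule closed_realization_carrier[OF finite_star[OF assms(1)]])
    fix J assume J: "J \<subseteq> Y" "J \<noteq> {}"
    have "{x. f x \<noteq> 0} \<in> star X J \<longleftrightarrow> (\<forall>y\<in>J. {x. f x \<noteq> 0} \<in> star X {y})" for f :: "'a \<Rightarrow> real"
      using J(2) unfolding star_def by blast
    then have "(\<Inter>y\<in>J. realization_carrier (star X {y})) = realization_carrier (star X J)"
      using J(2) unfolding realization_carrier_eq[OF abstract_complex_star] by blast
    moreover have "extensor TYPE('x) (realization_carrier (star X J))"
      using J assms by (intro extensor_star) blast+
    ultimately show "extensor TYPE('x) (\<Inter>y\<in>J. realization_carrier (star X {y}))"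
      by simp
  qed (rule assms(3))
  ultimately show ?thesis by simp
qed

lemma extensor_insert_vertex:
  assumes "finite X" "extensor TYPE('x::{metric_space,second_countable_topology}) (realization_carrier (VR X))"
    and link: "extensor TYPE('x) (realization_carrier (VR {z\<in>X. d v z \<le> r}))"
  shows "extensor TYPE('x) (realization_carrier (VR (insert v X)))"
proof -
  let ?S = "star (insert v X) {v}"
  have eq: "VR (insert v X) = VR X \<union> ?S"
    by (auto simp: star_def VR_simplices_def)
  have int: "VR X \<inter> ?S = VR {z\<in>X. d v z \<le> r}"
    by (auto simp: star_def VR_simplices_def)
  moreover have "extensor TYPE('x) (realization_carrier ?S)"
    using assms(1) self by (intro extensor_star) auto
  moreover have "realization_carrier (VR X \<inter> ?S) = realization_carrier (VR X) \<inter> realization_carrier ?S"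
    by (intro realization_carrier_Int abstract_complex_star) (simp_all add: abstract_complex_VR int)
  ultimately have "extensor TYPE('x) (realization_carrier (VR X) \<union> realization_carrier ?S)"
    using assms by (intro extensor_Un closed_realization_carrier finite_VR finite_star) auto
  then show ?thesis unfolding eq realization_carrier_Un .
qed

text \<open>The induction runs over the initial segments \<open>A\<close> of the order. When the
  maximal \<open>v\<close> is removed, exactly the points of \<open>B\<close> below \<open>v\<close>
  remain, so the link of \<open>v\<close> is determined by \<open>B\<close> alone.\<close>

lemma extensor_of_vertex_order:
  assumes fin: "finite B" and ne: "B \<noteq> {}"
    and order: "transp_on B lt" "asymp_on B lt" "totalp_on B lt"
    and dom: "\<And>v. v \<in> B \<Longrightarrow> \<exists>z\<in>B. lt z v \<Longrightarrow>
      \<exists>Y. Y \<subseteq> {z\<in>B. lt z v \<and> d v z \<le> r} \<and> Y \<noteq> {} \<and> (\<forall>x\<in>Y. \<forall>y\<in>Y. d x y \<le> r) \<and>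
        (\<forall>\<sigma>\<in>VR {z\<in>B. lt z v \<and> d v z \<le> r}. \<exists>y\<in>Y. \<forall>z\<in>\<sigma>. d y z \<le> r)"
  shows "extensor TYPE('x::{metric_space,second_countable_topology}) (realization_carrier (VR B))"
proof -
  have "extensor TYPE('x) (realization_carrier (VR A))"
    if "A \<subseteq> B" "A \<noteq> {}" "\<And>a b. a \<in> A \<Longrightarrow> b \<in> B \<Longrightarrow> lt b a \<Longrightarrow> b \<in> A" for A
    using that
  proof (induction "card A" arbitrary: A rule: less_induct)
    case less
    have finA: "finite A" using less.prems fin finite_subset by blast
    have "transp_on A lt" "asymp_on A lt" "totalp_on A lt"
      using order less.prems(1) by (blast intro: transp_on_subset asymp_on_subset totalp_on_subset)+
    then obtain v where v: "v \<in> A" "\<And>x. x \<in> A \<Longrightarrow> x \<noteq> v \<Longrightarrow> lt x v"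
      using Finite_Set.bex_max_element[of A lt] finA less.prems(2)
      by (metis totalp_onD)
    define A' where "A' = A - {v}"
    have irrefl: "\<not> lt v v" using order(2) v(1) less.prems(1) by (meson asymp_onD subsetD)
    have A': "A' = {z\<in>B. lt z v}"
      unfolding A'_def using v less.prems irrefl by blast
    have A: "A = insert v A'" using v by (auto simp: A'_def)
    show ?case
    proof (cases "A' = {}")
      \<comment> \<open>The empty complex is not an extensor, so the induction starts at a single
        point.\<close>
      case True
      have "VR {v} = star {v} {v}" by (auto simp: star_def VR_simplices_def)
      then show ?thesis
        using extensor_star[of "{v}" "{v}"] self A True by simp
    next
      case False
      have N: "{z\<in>A'. d v z \<le> r} = {z\<in>B. lt z v \<and> d v z \<le> r}"
        using A' by auto
      have finN: "finite {z\<in>B. lt z v \<and> d v z \<le> r}" using fin by simp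
      have low: "extensor TYPE('x) (realization_carrier (VR A'))"
      proof (rule less.hyps)
        show "card A' < card A" unfolding A'_def using v(1) finA by (meson card_Diff1_less)
        show "a \<in> A' \<Longrightarrow> b \<in> B \<Longrightarrow> lt b a \<Longrightarrow> b \<in> A'" for a b
          using transp_onD[OF order(1), of b a v] v(1) less.prems(1) unfolding A' by blast
      qed (use False A' in auto)
      have "v \<in> B" "\<exists>z\<in>B. lt z v" using v less.prems(1) False A' by blast+
      from dom[OF this] obtain Y where Y: "Y \<subseteq> {z\<in>B. lt z v \<and> d v z \<le> r}" "Y \<noteq> {}"
        "\<forall>x\<in>Y. \<forall>y\<in>Y. d x y \<le> r"
        "\<forall>\<sigma>\<in>VR {z\<in>B. lt z v \<and> d v z \<le> r}. \<exists>y\<in>Y. \<forall>z\<in>\<sigma>. d y z \<le> r"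
        by blast
      have "extensor TYPE('x) (realization_carrier (VR {z\<in>A'. d v z \<le> r}))"
        unfolding N by (rule extensor_star_cover[OF finN Y(1,2)]) (use Y(3,4) in blast)+
      then show ?thesis
        unfolding A using finA low by (intro extensor_insert_vertex) (auto simp: A'_def)
    qed
  qed
  then show ?thesis using ne by blast
qed

end

section \<open>Contracting an exhausted complex\<close>

lemma topspace_realization [simp]: "topspace (realization K) = realization_carrier K"
proof -
  have "realization_carrier K \<inter> simplex_set \<sigma> = simplex_set \<sigma>" if "\<sigma> \<in> K" for \<sigma>
    using that by (auto simp: realization_carrier_def)
  then have "realization_open K (realization_carrier K)"
    by (simp add: realization_open_def)
  moreover have "realization_open K U \<Longrightarrow> U \<subseteq> realization_carrier K" for U
    by (simp add: realization_open_def)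
  ultimately show ?thesis
    unfolding topspace_def openin_realization by blast
qed

lemma openin_realization_Int:
  assumes "open U"
  shows "openin (realization K) (realization_carrier K \<inter> U)"
  unfolding openin_realization realization_open_def
proof (intro conjI ballI)
  fix \<sigma> assume "\<sigma> \<in> K"
  then have "realization_carrier K \<inter> U \<inter> simplex_set \<sigma> = simplex_set \<sigma> \<inter> U"
    by (auto simp: realization_carrier_def)
  then show "openin (top_of_set (simplex_set \<sigma>)) (realization_carrier K \<inter> U \<inter> simplex_set \<sigma>)"
    using assms by (auto simp: openin_open)
qed simp

lemma continuous_map_realization_euclidean: "continuous_map (realization K) euclidean (\<lambda>x. x)"
  unfolding continuous_map_def
proof (intro conjI allI impI)
  fix U :: "('a \<Rightarrow> real) set" assume "openin euclidean U"
  moreover have "{x \<in> topspace (realization K). x \<in> U} = realization_carrier K \<inter> U" by auto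
  ultimately show "openin (realization K) {x \<in> topspace (realization K). x \<in> U}"
    using openin_realization_Int[of U K] by simp
qed simp

text \<open>On a finite subcomplex the weak topology is the topology of pointwise convergence.\<close>
lemma continuous_map_subcomplex_realization:
  assumes "finite L" "L \<subseteq> K"
  shows "continuous_map (top_of_set (realization_carrier L)) (realization K) (\<lambda>x. x)"
  unfolding continuous_map_def
proof (intro conjI allI impI)
  show "(\<lambda>x. x) \<in> topspace (top_of_set (realization_carrier L)) \<rightarrow> topspace (realization K)"
    using realization_carrier_mono[OF assms(2)] by auto
  fix U assume U: "openin (realization K) U"
  define F where "F = (\<Union>\<sigma>\<in>L. simplex_set \<sigma> - U)"
  have "closed (simplex_set \<sigma> - U)" if "\<sigma> \<in> L" for \<sigma>
  proof -
    have "openin (top_of_set (simplex_set \<sigma>)) (U \<inter> simplex_set \<sigma>)"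
      using U that assms(2) unfolding openin_realization realization_open_def by blast
    then have "closedin (top_of_set (simplex_set \<sigma>)) (simplex_set \<sigma> - U \<inter> simplex_set \<sigma>)"
      by (intro closedin_diff) simp_all
    moreover have "simplex_set \<sigma> - U \<inter> simplex_set \<sigma> = simplex_set \<sigma> - U" by blast
    ultimately show ?thesis using closed_simplex_set by (metis closedin_closed_trans)
  qed
  then have "closed F" unfolding F_def using assms(1) by blast
  moreover have "{x \<in> topspace (top_of_set (realization_carrier L)). x \<in> U} = realization_carrier L \<inter> - F"
    unfolding F_def realization_carrier_def by auto
  ultimately show "openin (top_of_set (realization_carrier L))
      {x \<in> topspace (top_of_set (realization_carrier L)). x \<in> U}"
    using openin_open_Int[of "- F"] by (simp add: open_Compl)
qed

text \<open>The empty map extends to a map on a nonempty space. This supplies the base point of the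
  contraction.\<close>

lemma extensor_nonempty:
  assumes "extensor TYPE('x::metric_space) S"
  shows "S \<noteq> {}"
proof -
  have "\<exists>g :: 'x \<Rightarrow> _. continuous_on UNIV g \<and> range g \<subseteq> S \<and> (\<forall>x\<in>{}. g x = undefined x)"
    using assms[unfolded extensor_def, rule_format, of "{}" undefined] by simp
  then show ?thesis by auto
qed

text \<open>The values prescribed on the bottom, the top and \<open>{0..1} \<times> A\<close> form a
  continuous map on a closed set, so one use of the extension property suffices. Starting from
  \<open>h\<close> keeps successive contractions compatible.\<close>

lemma extend_contraction:
  fixes X :: "'b::metric_space set" and h :: "real \<times> 'b \<Rightarrow> 'b"
  assumes X: "closed X" "extensor TYPE(real \<times> 'b) X" "p \<in> X"
    and A: "closed A" "A \<subseteq> X"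
    and h: "continuous_on ({0..1} \<times> A) h" "h ` ({0..1} \<times> A) \<subseteq> X"
      "\<And>x. x \<in> A \<Longrightarrow> h (0, x) = x" "\<And>x. x \<in> A \<Longrightarrow> h (1, x) = p"
  shows "\<exists>h'. (continuous_on UNIV h' \<and> range h' \<subseteq> X \<and>
      (\<forall>x\<in>X. h' (0, x) = x) \<and> (\<forall>x\<in>X. h' (1, x) = p)) \<and>
      (\<forall>t\<in>{0..1}. \<forall>x\<in>A. h' (t, x) = h (t, x))"
proof -
  define f where "f = (\<lambda>(t::real, x::'b). if t = 0 then x else if t = 1 then p else h (t, x))"
  define C where "C = ({0..1::real} \<times> A) \<union> (({0} \<times> X) \<union> ({1} \<times> X))"
  have fh: "f z = h z" if "z \<in> {0..1} \<times> A" for z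
    using that h(3,4) by (auto simp: f_def)
  have f0: "f z = snd z" if "z \<in> {0} \<times> X" for z using that by (auto simp: f_def)
  have f1: "f z = p" if "z \<in> {1} \<times> X" for z using that by (auto simp: f_def)
  have cont1: "continuous_on ({0..1} \<times> A) f"
    using h(1) by (rule continuous_on_eq) (simp add: fh)
  have "continuous_on ({0} \<times> X) snd" by (intro continuous_intros)
  then have cont2: "continuous_on ({0} \<times> X) f"
    by (rule continuous_on_eq) (simp add: f0)
  have "continuous_on ({1} \<times> X) (\<lambda>_. p)" by simp
  then have cont3: "continuous_on ({1} \<times> X) f"
    by (rule continuous_on_eq) (simp add: f1)
  have 1: "closed C"
    unfolding C_def using X(1) A(1) by (intro closed_Un closed_Times closed_singleton closed_real_atLeastAtMost)
  have 2: "continuous_on C f"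
    unfolding C_def using X(1) A(1) cont1 cont2 cont3
    by (intro continuous_on_closed_Un closed_Un closed_Times closed_singleton closed_real_atLeastAtMost)
  have 3: "f ` C \<subseteq> X"
  proof
    fix y assume "y \<in> f ` C"
    then obtain z where z: "y = f z" "z \<in> C" by (rule imageE)
    consider "z \<in> {0..1} \<times> A" | "z \<in> {0} \<times> X" | "z \<in> {1} \<times> X"
      using z(2) unfolding C_def Un_iff by argo
    then show "y \<in> X"
    proof cases
      case 1
      then have "h z \<in> X" by (rule h(2)[unfolded image_subset_iff, rule_format])
      then show ?thesis using fh[OF 1] z(1) by simp
    next
      case 2
      then have "snd z \<in> X" by auto
      then show ?thesis using f0[OF 2] z(1) by simp
    next
      case 3
      then show ?thesis using f1[OF 3] X(3) z(1) by simp
    qed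
  qed
  have "\<exists>g. continuous_on UNIV g \<and> range g \<subseteq> X \<and> (\<forall>z\<in>C. g z = f z)"
    by (rule X(2)[unfolded extensor_def, rule_format, OF 1 2 3])
  then obtain g where g: "continuous_on UNIV g" "range g \<subseteq> X" "\<And>z. z \<in> C \<Longrightarrow> g z = f z"
    by blast
  have "\<forall>x\<in>X. g (0, x) = x" "\<forall>x\<in>X. g (1, x) = p"
    using g(3) by (auto simp: C_def f_def)
  moreover have "g (t, x) = h (t, x)" if "t \<in> {0..1}" "x \<in> A" for t x
    using g(3)[of "(t, x)"] fh[of "(t, x)"] that by (auto simp: C_def)
  ultimately show ?thesis using g(1,2) by (intro exI[of _ g]) blast
qed

text \<open>Continuity on the product of the interval with a weak topology is checked locally: by
  local finiteness the open star \<open>U v\<close> of a vertex lies in a finite stage, where the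
  weak topology is that of pointwise convergence and the contraction is already known to be
  continuous.\<close>

theorem contractible_exhaustion:
  fixes K :: "'a::countable set set" and L :: "nat \<Rightarrow> 'a set set"
  assumes K: "abstract_complex K"
    and L: "\<And>n. finite (L n)" "\<And>n. L n \<subseteq> K" "\<And>n. L n \<subseteq> L (Suc n)"
    and ext: "\<And>n. extensor TYPE(real \<times> ('a \<Rightarrow> real)) (realization_carrier (L n))"
    and locally_finite: "\<And>v. \<exists>n. \<forall>\<sigma>\<in>K. v \<in> \<sigma> \<longrightarrow> \<sigma> \<in> L n"
  shows "contractible_space (realization K)"
proof -
  define X where "X n = realization_carrier (L n)" for n
  have clX: "closed (X n)" for n
    unfolding X_def by (rule closed_realization_carrier[OF L(1)])
  have XSuc: "X n \<subseteq> X (Suc n)" for n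
    unfolding X_def by (rule realization_carrier_mono[OF L(3)])
  have Xmono: "X m \<subseteq> X n" if "m \<le> n" for m n
    using lift_Suc_mono_le[of X, OF XSuc that] .
  have extX: "extensor TYPE(real \<times> ('a \<Rightarrow> real)) (X n)" for n
    unfolding X_def by (rule ext)
  obtain p where p: "p \<in> X 0" using extensor_nonempty[OF extX] by blast
  then have pX: "p \<in> X n" for n using Xmono[of 0 n] by auto
  define P where "P n h \<longleftrightarrow> continuous_on UNIV h \<and> range h \<subseteq> X n \<and>
      (\<forall>x\<in>X n. h (0, x) = x) \<and> (\<forall>x\<in>X n. h (1, x) = p)" for n and h :: "real \<times> ('a \<Rightarrow> real) \<Rightarrow> 'a \<Rightarrow> real"
  define Q where "Q n h h' \<longleftrightarrow> (\<forall>t\<in>{0..1}. \<forall>x\<in>X n. h' (t, x) = h (t, x))"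
    for n and h h' :: "real \<times> ('a \<Rightarrow> real) \<Rightarrow> 'a \<Rightarrow> real"
  have "\<exists>H. \<forall>n. P n (H n) \<and> Q n (H n) (H (Suc n))"
  proof (rule dependent_nat_choice)
    show "\<exists>h. P 0 h"
      \<comment> \<open>Nothing has been contracted yet: the extension starts from the empty set,
        and \<open>snd\<close> is a placeholder for \<open>h\<close>.\<close>
      using extend_contraction[OF clX[of 0] extX[of 0] pX[of 0], of "{}" snd]
      unfolding P_def by auto
  next
    fix h n assume "P n h"
    then have h: "continuous_on UNIV h" "range h \<subseteq> X n"
      "\<And>x. x \<in> X n \<Longrightarrow> h (0, x) = x" "\<And>x. x \<in> X n \<Longrightarrow> h (1, x) = p"
      unfolding P_def by blast+
    have c: "continuous_on ({0..1} \<times> X n) h" using h(1) by (rule continuous_on_subset) simp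
    have i: "h ` ({0..1} \<times> X n) \<subseteq> X (Suc n)" using h(2) XSuc[of n] by blast
    show "\<exists>h'. P (Suc n) h' \<and> Q n h h'"
      unfolding P_def Q_def
      by (rule extend_contraction[OF clX extX pX clX XSuc c i h(3,4)])
  qed
  then obtain H where H: "\<And>n. P n (H n)" "\<And>n. Q n (H n) (H (Suc n))" by blast
  have stable: "H n (t, x) = H m (t, x)" if "m \<le> n" "t \<in> {0..1}" "x \<in> X m" for m n t x
    using that(1)
  proof (induction n rule: dec_induct)
    case (step k)
    then have "x \<in> X k" using Xmono[of m k] that(3) by auto
    then show ?case using H(2)[of k] that(2) step.IH unfolding Q_def by auto
  qed simp
  have agree: "H n (t, x) = H m (t, x)" if "t \<in> {0..1}" "x \<in> X m" "x \<in> X n" for m n t x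
    using stable[of m n t x] stable[of n m t x] that by (cases "m \<le> n") auto
  define U where "U v = realization_carrier K \<inter> {q. 0 < q v}" for v
  have cover: "\<exists>v. q \<in> U v" if "q \<in> realization_carrier K" for q
  proof -
    have q: "\<forall>x. 0 \<le> q x" "{x. q x \<noteq> 0} \<in> K"
      using that unfolding realization_carrier_eq[OF K] by auto
    have "{x. q x \<noteq> 0} \<noteq> {}" using K[unfolded abstract_complex_def, rule_format, OF q(2)] by simp
    then obtain v where "q v \<noteq> 0" by blast
    then have "0 < q v" using q(1) by (metis order_le_less)
    then show ?thesis using that by (auto simp: U_def)
  qed
  obtain N where N: "\<And>v \<sigma>. \<sigma> \<in> K \<Longrightarrow> v \<in> \<sigma> \<Longrightarrow> \<sigma> \<in> L (N v)"
    using locally_finite by metis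
  have UX: "U v \<subseteq> X (N v)" for v
  proof
    fix q assume "q \<in> U v"
    then have q: "\<forall>x. 0 \<le> q x" "{x. q x \<noteq> 0} \<in> K" "sum q {x. q x \<noteq> 0} = 1" "0 < q v"
      unfolding U_def realization_carrier_eq[OF K] by auto
    have S: "{x. q x \<noteq> 0} \<in> L (N v)" using N[OF q(2), of v] q(4) by auto
    have "finite {x. q x \<noteq> 0}" using K q(2) unfolding abstract_complex_def by blast
    then have "q \<in> simplex_set {x. q x \<noteq> 0}" using q by (simp add: simplex_set_iff)
    then show "q \<in> X (N v)" unfolding X_def realization_carrier_def using S by blast
  qed
  \<comment> \<open>Any \<open>v\<close> whose open star contains \<open>x\<close> may be chosen,
    since the stages agree at their common points.\<close>
  define G where "G = (\<lambda>(t, x). H (N (SOME v. x \<in> U v)) (t, x))"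
  have G: "G (t, x) = H (N v) (t, x)" if "t \<in> {0..1}" "x \<in> U v" for t x v
  proof -
    have "x \<in> U (SOME v. x \<in> U v)" using that(2) by (rule someI)
    then have "x \<in> X (N (SOME v. x \<in> U v))" "x \<in> X (N v)" using UX that(2) by blast+
    then show ?thesis unfolding G_def prod.case by (rule agree[OF that(1), rotated])
  qed
  let ?T = "prod_topology (top_of_set {0..1::real}) (realization K)"
  have "continuous_map ?T (realization K) G"
  proof (rule pasting_lemma[where I = UNIV and T = "\<lambda>v. {0..1} \<times> U v" and f = "\<lambda>v. H (N v)"])
    fix v
    have "open {q :: 'a \<Rightarrow> real. 0 < q v}"
      by (intro open_Collect_less continuous_on_const continuous_on_product_coordinates)
    then show "openin ?T ({0..1} \<times> U v)"
      unfolding openin_prod_Times_iff U_def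
      using openin_realization_Int[of "{q. 0 < q v}" K] by simp
    have "continuous_map (top_of_set {0..1::real}) euclidean (\<lambda>t. t)"
      by (simp add: continuous_map_iff_continuous[of _ id, unfolded id_def])
    then have "continuous_map ?T (prod_topology euclidean euclidean) (\<lambda>(t, x). (t, x))"
      unfolding continuous_map_prod_top
      using continuous_map_realization_euclidean[of K] by blast
    then have c1: "continuous_map ?T euclidean (\<lambda>z. z)"
      by (simp add: case_prod_unfold)
    have c2: "continuous_map euclidean (top_of_set (X (N v))) (H (N v))"
      using H(1)[of "N v"] unfolding P_def by (auto simp: continuous_map_in_subtopology)
    have c3: "continuous_map (top_of_set (X (N v))) (realization K) (\<lambda>x. x)"
      unfolding X_def by (rule continuous_map_subcomplex_realization[OF L(1,2)])
    \<comment> \<open>Factorisation: from the weak to the pointwise topology, by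
      \<open>H (N v)\<close> into a finite stage, and from there back into the weak
      topology.\<close>
    have "continuous_map ?T (realization K) (H (N v))"
      using continuous_map_compose[OF continuous_map_compose[OF c1 c2] c3] by (simp add: o_def)
    then show "continuous_map (subtopology ?T ({0..1} \<times> U v)) (realization K) (H (N v))"
      by (rule continuous_map_from_subtopology)
  next
    fix v w z assume "z \<in> topspace ?T \<inter> ({0..1} \<times> U v) \<inter> ({0..1} \<times> U w)"
    then show "H (N v) z = H (N w) z"
      using agree[of "fst z" "snd z" "N w" "N v"] UX[of v, THEN subsetD, of "snd z"]
        UX[of w, THEN subsetD, of "snd z"] by auto
  next
    fix z assume "z \<in> topspace ?T"
    then obtain t x where z: "z = (t, x)" "t \<in> {0..1}" "x \<in> realization_carrier K" by auto
    moreover obtain v where "x \<in> U v" using cover[OF z(3)] by blast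
    ultimately show "\<exists>v. v \<in> UNIV \<and> z \<in> {0..1} \<times> U v \<and> G z = H (N v) z"
      using G[of t x v] by (intro exI[of _ v]) simp
  qed
  moreover have "G (0, x) = x \<and> G (1, x) = p" if x: "x \<in> realization_carrier K" for x
  proof -
    obtain v where v: "x \<in> U v" using cover[OF x] by blast
    then show ?thesis
      using G[of 0 x v] G[of 1 x v] H(1)[of "N v"] UX[of v, THEN subsetD, OF v]
      unfolding P_def by simp
  qed
  ultimately have "homotopic_with (\<lambda>x. True) (realization K) (realization K) id (\<lambda>x. p)"
    by (subst homotopic_with) auto
  then show ?thesis unfolding contractible_space_def by blast
qed

section \<open>Cliques in the lattice\<close>

text \<open>Five coordinates serve all dimensions at once: vectors of smaller dimension are padded
  with zeros.\<close>

definition len :: "(nat \<Rightarrow> int) \<Rightarrow> int" where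
  "len w = (\<Sum>i<5. \<bar>w i\<bar>)"

text \<open>The cancelling part of a distance: \<open>\<bar>a - b\<bar>\<close> falls short of
  \<open>\<bar>a\<bar> + \<bar>b\<bar>\<close> by twice this number.\<close>

definition overlap :: "int \<Rightarrow> int \<Rightarrow> int" where
  "overlap a b = (if 0 < a \<and> 0 < b then min a b else if a < 0 \<and> b < 0 then min (- a) (- b) else 0)"

lemma len_eq: "len w = \<bar>w 0\<bar> + \<bar>w 1\<bar> + \<bar>w 2\<bar> + \<bar>w 3\<bar> + \<bar>w 4\<bar>"
  by (simp add: len_def eval_nat_numeral)

lemma abs_diff_eq_overlap: "\<bar>a - b\<bar> = \<bar>a\<bar> + \<bar>b\<bar> - 2 * overlap a b"
  by (auto simp: overlap_def)

lemma overlap_le: "overlap a b \<le> \<bar>a\<bar>" "overlap a b \<le> \<bar>b\<bar>" "0 \<le> overlap a b"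
  by (auto simp: overlap_def)

lemma overlap_eq_0: "a \<le> 0 \<Longrightarrow> 0 \<le> b \<Longrightarrow> overlap a b = 0" "0 \<le> a \<Longrightarrow> b \<le> 0 \<Longrightarrow> overlap a b = 0"
  by (auto simp: overlap_def)

lemma overlap_pos_iff: "0 < overlap a b \<longleftrightarrow> 0 < a * b"
  by (auto simp: overlap_def zero_less_mult_iff)

definition overlaps :: "(nat \<Rightarrow> int) \<Rightarrow> (nat \<Rightarrow> int) \<Rightarrow> int" where
  "overlaps x y = overlap (x 0) (y 0) + overlap (x 1) (y 1) + overlap (x 2) (y 2)
     + overlap (x 3) (y 3) + overlap (x 4) (y 4)"

lemma len_diff: "len (\<lambda>i. x i - y i) = len x + len y - 2 * overlaps x y"
  unfolding len_eq overlaps_def abs_diff_eq_overlap by simp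

text \<open>Lexicographic positivity, written out so that the order axioms become linear arithmetic;
  z precedes v when v - z satisfies it.\<close>

definition lexpos :: "(nat \<Rightarrow> int) \<Rightarrow> bool" where
  "lexpos w \<longleftrightarrow> 0 < w 0 \<or> w 0 = 0 \<and> (0 < w 1 \<or> w 1 = 0 \<and> (0 < w 2 \<or> w 2 = 0 \<and>
     (0 < w 3 \<or> w 3 = 0 \<and> 0 < w 4)))"

text \<open>Coordinates are passed as separate numbers so that the last two can be exchanged:
  \<open>b\<close>, \<open>e\<close>, \<open>f\<close>, \<open>t\<close> are vectors and \<open>i\<close>, \<open>j\<close> stand for the coordinates 3, 4 in either order.
  The vector \<open>(0, 0, 1, p, p)\<close> of length \<open>2p + 1\<close> is a further member of the clique.\<close>
lemma heavy_triple_aux: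
  fixes x0 :: int
  assumes r: "6 \<le> r" and p: "r - 1 \<le> 2 * p + 1"
    and \<beta>: "\<bar>b0\<bar> + \<bar>b1\<bar> + \<bar>b2\<bar> + \<bar>bi\<bar> + \<bar>bj\<bar> = r - 1" "b2 \<le> 0" "bj \<le> 0" "0 < bi" "2 * bi \<ge> r - 2"
    and \<epsilon>: "\<bar>e0\<bar> + \<bar>e1\<bar> + \<bar>e2\<bar> + \<bar>ei\<bar> + \<bar>ej\<bar> = E" "r - 1 \<le> E" "e0 = 0" "0 \<le> e1" "ei \<le> 0"
    and \<epsilon>': "\<bar>f0\<bar> + \<bar>f1\<bar> + \<bar>f2\<bar> + \<bar>fi\<bar> + \<bar>fj\<bar> = F" "r - 1 \<le> F" "f1 \<le> 0" "fi \<le> 0"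
    and \<theta>: "t0 \<le> 0" "0 < ti" "tj \<le> 0"
    and \<epsilon>u: "E + (2 * p + 1) - r \<le> 2 * overlap e2 1 + 2 * overlap ei p + 2 * overlap ej p"
    and fu: "F + (2 * p + 1) - r \<le> 2 * overlap f2 1 + 2 * overlap fi p + 2 * overlap fj p"
    and \<epsilon>\<beta>: "E + (r - 1) - r \<le> 2 * overlap e0 b0 + 2 * overlap e1 b1 + 2 * overlap e2 b2 + 2 * overlap ei bi + 2 * overlap ej bj"
    and f\<beta>: "F + (r - 1) - r \<le> 2 * overlap f0 b0 + 2 * overlap f1 b1 + 2 * overlap f2 b2 + 2 * overlap fi bi + 2 * overlap fj bj"
    and \<theta>u: "r + (2 * p + 1) - r \<le> 2 * overlap t2 1 + 2 * overlap ti p + 2 * overlap tj p"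
    and \<epsilon>\<theta>: "E + r - r \<le> 2 * overlap e0 t0 + 2 * overlap e1 t1 + 2 * overlap e2 t2 + 2 * overlap ei ti + 2 * overlap ej tj"
  shows "e2 = 0 \<and> ei = 0"
proof -
  have p0: "0 \<le> p" using r p by linarith
  have "overlap tj p = 0" using \<theta>(3) p0 by (simp add: overlap_eq_0)
  \<comment> \<open>The required amount \<open>2 * p + 1\<close> exceeds the \<open>2 * p\<close>
    that coordinate \<open>i\<close> can contribute.\<close>
  then have "overlap t2 1 > 0" using \<theta>u overlap_le(2)[of ti p] p0 by linarith
  then have t2: "0 < t2" by (simp add: overlap_pos_iff)
  have u3: "overlap ei p = 0" "overlap fi p = 0" using \<epsilon>(5) \<epsilon>'(4) p0 by (simp_all add: overlap_eq_0)
  \<comment> \<open>Coordinate 2 contributes at most 2, whereas at least \<open>r - 2\<close> is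
    required and \<open>r\<close> is at least 6.\<close>
  have "overlap ej p > 0" using \<epsilon>u u3 overlap_le(2)[of e2 1] r p \<epsilon>(2) by linarith
  then have ej: "0 < ej" using p0 by (auto simp: overlap_pos_iff zero_less_mult_iff)
  have "overlap fj p > 0" using fu u3 overlap_le(2)[of f2 1] r p \<epsilon>'(2) by linarith
  then have fj: "0 < fj" using p0 by (auto simp: overlap_pos_iff zero_less_mult_iff)
  \<comment> \<open>A positive \<open>e2\<close> would leave \<open>e\<close> and \<open>b\<close>
    only coordinate 1 to share, and then \<open>f\<close> and \<open>b\<close> only coordinates 0
    and 2. Together with \<open>bi\<close>, three disjoint parts of \<open>b\<close> would each have
    size at least \<open>(r - 2) / 2\<close>, too much for its length \<open>r - 1\<close>.\<close>
  have e2: "e2 \<le> 0"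
  proof (rule ccontr)
    assume "\<not> e2 \<le> 0"
    then have "overlap e2 b2 = 0" "overlap ei bi = 0" "overlap ej bj = 0" "overlap e0 b0 = 0"
      using \<beta> \<epsilon>(3,5) ej by (simp_all add: overlap_eq_0 overlap_def)
    then have e1b1: "2 * overlap e1 b1 \<ge> r - 2" using \<epsilon>\<beta> \<epsilon>(2) by linarith
    then have b1: "0 < b1" using overlap_pos_iff[of e1 b1] \<epsilon>(4) r by (auto simp: zero_less_mult_iff)
    have "overlap f1 b1 = 0" "overlap fi bi = 0" "overlap fj bj = 0"
      using b1 \<beta> \<epsilon>'(3,4) fj by (simp_all add: overlap_eq_0)
    then have "2 * \<bar>b0\<bar> + 2 * \<bar>b2\<bar> \<ge> r - 2"
      using f\<beta> \<epsilon>'(2) overlap_le(2)[of f0 b0] overlap_le(2)[of f2 b2] by linarith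
    moreover have "2 * \<bar>b1\<bar> \<ge> r - 2" using e1b1 overlap_le(2)[of e1 b1] by linarith
    ultimately show False using \<beta>(1,4,5) r by linarith
  qed
  \<comment> \<open>Now \<open>e\<close> shares only coordinate 1 with \<open>t\<close> and only
    coordinate \<open>j\<close> with \<open>(0, 0, 1, p, p)\<close>. The two bounds add up to
    \<open>E - 1/2\<close>, so by integrality these coordinates exhaust \<open>e\<close>.\<close>
  have "overlap e0 t0 = 0" "overlap e2 t2 = 0" "overlap ei ti = 0" "overlap ej tj = 0"
    using \<epsilon>(3,5) e2 t2 \<theta> ej by (simp_all add: overlap_eq_0 overlap_def)
  then have 1: "2 * \<bar>e1\<bar> \<ge> E" using \<epsilon>\<theta> overlap_le(1)[of e1 t1] by linarith
  have "overlap e2 1 = 0" using e2 by (simp add: overlap_eq_0)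
  then have 2: "2 * \<bar>ej\<bar> \<ge> E - 1" using \<epsilon>u u3 overlap_le(1)[of ej p] p by linarith
  show ?thesis using 1 2 \<epsilon>(1) by linarith
qed

text \<open>The members of \<open>S\<close> are the differences \<open>v - z\<close> for \<open>z\<close> in a clique of lower neighbours of \<open>v\<close>;
  by \<open>len_diff\<close> the second assumption says that they have pairwise distance at most \<open>r\<close>.\<close>
locale heavy =
  fixes S :: "(nat \<Rightarrow> int) set" and r :: int
  assumes bound: "w \<in> S \<Longrightarrow> len w \<le> r"
    and close: "x \<in> S \<Longrightarrow> y \<in> S \<Longrightarrow> len x + len y - r \<le> 2 * overlaps x y"
begin

text \<open>The threshold is \<open>r - 1\<close> rather than \<open>r\<close> because subtracting
  two signs can lengthen a vector by 2.\<close>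

definition hv :: "(nat \<Rightarrow> int) set" where "hv = {w\<in>S. r - 1 \<le> len w}"

text \<open>If no pair of coordinates in the list meets every heavy vector, then \<open>u\<close> is forced to be
  \<open>(0, 0, 1, p, p)\<close>; this excludes \<open>r = 5\<close> and makes the triple \<open>{0, 3, 4}\<close> work.\<close>
lemma no_hitting_pair:
  assumes r: "5 \<le> r"
    and lex: "\<And>w. w \<in> hv \<Longrightarrow> 0 < w 0 \<or> w 0 = 0 \<and> (0 < w 1 \<or> w 1 = 0 \<and> 0 < w 2)"
    and supp: "\<And>w i j. w \<in> hv \<Longrightarrow> \<exists>k<5. k \<noteq> i \<and> k \<noteq> j \<and> w k \<noteq> 0"
    and u: "u \<in> hv" "u 0 = 0" "u 1 = 0" "0 < u 2" "0 < u 3" "0 < u 4"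
    and pairs: "\<And>i j. (i, j) \<in> {(2,3),(2,4),(0,3),(0,4),(1,3),(1,4)} \<Longrightarrow>
      \<exists>w\<in>hv. w i \<le> 0 \<and> w j \<le> 0"
  shows "6 \<le> r"
    and "w \<in> S \<Longrightarrow> r - 2 \<le> len w \<Longrightarrow> 0 < w 3 \<or> 0 < w 4"
    and "w \<in> S \<Longrightarrow> len w = r \<Longrightarrow> 0 < w 0 \<or> 0 < w 3 \<and> 0 < w 4"
proof -
  have S: "x \<in> S" "r - 1 \<le> len x" if "x \<in> hv" for x using that by (auto simp: hv_def)
  obtain a where a: "a \<in> hv" "a 2 \<le> 0" "a 3 \<le> 0" using pairs[of 2 3] by auto
  obtain b where b: "b \<in> hv" "b 2 \<le> 0" "b 4 \<le> 0" using pairs[of 2 4] by auto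
  obtain e where e: "e \<in> hv" "e 0 \<le> 0" "e 3 \<le> 0" using pairs[of 0 3] by auto
  obtain f where f: "f \<in> hv" "f 1 \<le> 0" "f 3 \<le> 0" using pairs[of 1 3] by auto
  obtain k where k: "k \<in> hv" "k 0 \<le> 0" "k 4 \<le> 0" using pairs[of 0 4] by auto
  obtain l where l: "l \<in> hv" "l 1 \<le> 0" "l 4 \<le> 0" using pairs[of 1 4] by auto
  have cl: "len x + len y - r \<le> 2 * overlap (x 0) (y 0) + 2 * overlap (x 1) (y 1) + 2 * overlap (x 2) (y 2) + 2 * overlap (x 3) (y 3) + 2 * overlap (x 4) (y 4)" if "x \<in> S" "y \<in> S" for x y
    using close[OF that] unfolding overlaps_def by (simp add: algebra_simps)
  have clu: "len x + len u - r \<le> 2 * overlap (x 2) (u 2) + 2 * overlap (x 3) (u 3) + 2 * overlap (x 4) (u 4)"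
    if "x \<in> S" for x
    using cl[OF that S(1)[OF u(1)]] u by (simp add: overlap_def)
  have lu: "len u = u 2 + u 3 + u 4" using u by (simp add: len_eq)
  have ru: "r - 1 \<le> len u" "len u \<le> r" using S[OF u(1)] bound by auto
  \<comment> \<open>All overlap of \<open>a\<close> with \<open>u\<close> sits in coordinate 4 and
    takes about half of \<open>u\<close>; that of \<open>b\<close> takes the other half in
    coordinate 3.\<close>
  have "overlap (a 2) (u 2) = 0" "overlap (a 3) (u 3) = 0" using a u by (simp_all add: overlap_eq_0)
  then have au: "len a + len u - r \<le> 2 * overlap (a 4) (u 4)" using clu[OF S(1)[OF a(1)]] by linarith
  have "overlap (b 2) (u 2) = 0" "overlap (b 4) (u 4) = 0" using b u by (simp_all add: overlap_eq_0)
  then have bu: "len b + len u - r \<le> 2 * overlap (b 3) (u 3)" using clu[OF S(1)[OF b(1)]] by linarith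
  have "0 < overlap (a 4) (u 4)" using au S(2)[OF a(1)] ru r by linarith
  then have a4: "0 < a 4" using u by (simp add: overlap_pos_iff zero_less_mult_iff)
  have "0 < overlap (b 3) (u 3)" using bu S(2)[OF b(1)] ru r by linarith
  then have b3: "0 < b 3" using u by (simp add: overlap_pos_iff zero_less_mult_iff)
  have a4': "len a + len u - r \<le> 2 * a 4" "len a + len u - r \<le> 2 * u 4"
    using au overlap_le[of "a 4" "u 4"] a4 u by linarith+
  have b3': "len b + len u - r \<le> 2 * b 3" "len b + len u - r \<le> 2 * u 3"
    using bu overlap_le[of "b 3" "u 3"] b3 u by linarith+
  \<comment> \<open>Both halves fit only if nothing is to spare, which fixes \<open>u 2\<close> and
    the lengths of \<open>a\<close> and \<open>b\<close>.\<close>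
  have la: "len a = r - 1" and lb: "len b = r - 1" and u2: "u 2 = 1"
    using a4'(2) b3'(2) lu S(2)[OF a(1)] S(2)[OF b(1)] u by linarith+
  have u34: "u 3 = u 4" using a4'(2) b3'(2) lu la lb u2 by linarith
  define p where "p = u 3"
  have up: "u 3 = p" "u 4 = p" "len u = 2 * p + 1" using u34 lu u2 by (auto simp: p_def)
  show r6: "6 \<le> r"
  proof (rule ccontr)
    assume "\<not> 6 \<le> r"
    \<comment> \<open>For \<open>r = 5\<close>, coordinate 3 takes at least 2 of the length 4 of
      \<open>b\<close>. Comparison with \<open>a\<close>, \<open>e\<close>, \<open>f\<close> shows
      in turn that \<open>b\<close> vanishes at 4, 0 and 1, so \<open>b 2\<close> would have to be
      positive.\<close>
    then have r5: "r = 5" using r by linarith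
    then have p2: "p = 2" using up(3) ru by presburger
    have B: "2 \<le> b 3" "len b = 4" "2 \<le> a 4" using b3' a4' up p2 r5 la lb by linarith+
    have "overlap (a 3) (b 3) = 0" "overlap (a 4) (b 4) = 0" using a b a4 b3 by (simp_all add: overlap_eq_0)
    then have "3 \<le> 2 * \<bar>b 0\<bar> + 2 * \<bar>b 1\<bar> + 2 * \<bar>b 2\<bar>"
      using cl[OF S(1)[OF a(1)] S(1)[OF b(1)]] la lb r5 overlap_le(2)[of "a 0" "b 0"]
        overlap_le(2)[of "a 1" "b 1"] overlap_le(2)[of "a 2" "b 2"] by linarith
    then have b4: "b 4 = 0" using B(1,2) unfolding len_eq[of b] by linarith
    have e0: "e 0 = 0" using lex[OF e(1)] e(2) by linarith
    have "overlap (e 0) (b 0) = 0" "overlap (e 3) (b 3) = 0" "overlap (e 4) (b 4) = 0"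
      using e0 e(3) b3 b4 by (simp_all add: overlap_eq_0 overlap_def)
    then have "3 \<le> 2 * \<bar>b 1\<bar> + 2 * \<bar>b 2\<bar>"
      using cl[OF S(1)[OF e(1)] S(1)[OF b(1)]] lb r5 S(2)[OF e(1)]
        overlap_le(2)[of "e 1" "b 1"] overlap_le(2)[of "e 2" "b 2"] by linarith
    then have b0: "b 0 = 0" using B(1,2) unfolding len_eq[of b] by linarith
    have "b 1 \<ge> 0" using lex[OF b(1)] b0 by linarith
    then have "overlap (f 1) (b 1) = 0" "overlap (f 3) (b 3) = 0" "overlap (f 4) (b 4) = 0"
      using f(2,3) b3 b4 by (simp_all add: overlap_eq_0 overlap_def)
    then have "3 \<le> 2 * \<bar>b 0\<bar> + 2 * \<bar>b 2\<bar>"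
      using cl[OF S(1)[OF f(1)] S(1)[OF b(1)]] lb r5 S(2)[OF f(1)]
        overlap_le(2)[of "f 0" "b 0"] overlap_le(2)[of "f 2" "b 2"] by linarith
    then have b1: "b 1 = 0" using B(1,2) unfolding len_eq[of b] by linarith
    show False using lex[OF b(1)] b0 b1 b(2) by linarith
  qed
  have one: "0 < w 3 \<or> 0 < w 4" if "w \<in> S" "r - 2 \<le> len w" for w
  proof (rule ccontr)
    assume "\<not> (0 < w 3 \<or> 0 < w 4)"
    then have "overlap (w 3) (u 3) = 0" "overlap (w 4) (u 4) = 0" using u by (simp_all add: overlap_eq_0)
    \<comment> \<open>Only coordinate 2 is left, with overlap at most 1, but at least
      \<open>(r - 3) / 2\<close> is needed and \<open>r \<ge> 6\<close>.\<close>
    then show False using clu[OF that(1)] that(2) ru r6 u2 overlap_le(2)[of "w 2" "u 2"] by linarith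
  qed
  then show "w \<in> S \<Longrightarrow> r - 2 \<le> len w \<Longrightarrow> 0 < w 3 \<or> 0 < w 4" .
  assume w: "w \<in> S" "len w = r"
  show "0 < w 0 \<or> 0 < w 3 \<and> 0 < w 4"
  proof (rule ccontr)
    assume neg: "\<not> (0 < w 0 \<or> 0 < w 3 \<and> 0 < w 4)"
    have rp: "r - 1 \<le> 2 * p + 1" using ru up by simp
    have e0: "e 0 = 0" "0 \<le> e 1" using lex[OF e(1)] e(2) by linarith+
    have k0: "k 0 = 0" "0 \<le> k 1" using lex[OF k(1)] k(2) by linarith+
    note Sx = S[OF a(1)] S[OF b(1)] S[OF e(1)] S[OF f(1)] S[OF k(1)] S[OF l(1)]
    have clup: "len x + (2 * p + 1) - r \<le> 2 * overlap (x 2) 1 + 2 * overlap (x 3) p + 2 * overlap (x 4) p"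
      if "x \<in> S" for x using clu[OF that] up u2 by simp
    \<comment> \<open>Exchanging coordinates 3 and 4 turns one case into the other, with
      \<open>a\<close>, \<open>k\<close>, \<open>l\<close> in place of \<open>b\<close>,
      \<open>e\<close>, \<open>f\<close>.\<close>
    consider "0 < w 3" "w 4 \<le> 0" | "0 < w 4" "w 3 \<le> 0" using one[OF w(1)] w(2) neg by force
    then show False
    proof cases
      case 1
      have "e 2 = 0 \<and> e 3 = 0"
      proof (rule heavy_triple_aux[OF r6 rp, where bi = "b 3" and bj = "b 4" and ej = "e 4"
            and fi = "f 3" and fj = "f 4" and ti = "w 3" and tj = "w 4" and E = "len e" and F = "len f"
            and ?b0.0 = "b 0" and ?b1.0 = "b 1" and ?b2.0 = "b 2" and ?e0.0 = "e 0" and ?e1.0 = "e 1"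
            and ?f0.0 = "f 0" and ?f1.0 = "f 1" and ?f2.0 = "f 2" and ?t0.0 = "w 0" and ?t1.0 = "w 1" and ?t2.0 = "w 2"])
        show "\<bar>b 0\<bar> + \<bar>b 1\<bar> + \<bar>b 2\<bar> + \<bar>b 3\<bar> + \<bar>b 4\<bar> = r - 1"
          "\<bar>e 0\<bar> + \<bar>e 1\<bar> + \<bar>e 2\<bar> + \<bar>e 3\<bar> + \<bar>e 4\<bar> = len e"
          "\<bar>f 0\<bar> + \<bar>f 1\<bar> + \<bar>f 2\<bar> + \<bar>f 3\<bar> + \<bar>f 4\<bar> = len f"
          using lb by (simp_all add: len_eq)
        show "b 2 \<le> 0" "b 4 \<le> 0" "0 < b 3" "e 0 = 0" "0 \<le> e 1" "e 3 \<le> 0"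
          "f 1 \<le> 0" "f 3 \<le> 0" by fact+
        show "r - 2 \<le> 2 * b 3" using b3'(1) lb ru by linarith
        show "r - 1 \<le> len e" "r - 1 \<le> len f" by fact+
        show "w 0 \<le> 0" "0 < w 3" "w 4 \<le> 0" using neg 1 by linarith+
        show "len e + (2 * p + 1) - r \<le> 2 * overlap (e 2) 1 + 2 * overlap (e 3) p + 2 * overlap (e 4) p"
          "len f + (2 * p + 1) - r \<le> 2 * overlap (f 2) 1 + 2 * overlap (f 3) p + 2 * overlap (f 4) p"
          "r + (2 * p + 1) - r \<le> 2 * overlap (w 2) 1 + 2 * overlap (w 3) p + 2 * overlap (w 4) p"
          using clup[of e] clup[of f] clup[of w] w Sx by simp_all
        show "len e + (r - 1) - r \<le> 2 * overlap (e 0) (b 0) + 2 * overlap (e 1) (b 1)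
            + 2 * overlap (e 2) (b 2) + 2 * overlap (e 3) (b 3) + 2 * overlap (e 4) (b 4)"
          "len f + (r - 1) - r \<le> 2 * overlap (f 0) (b 0) + 2 * overlap (f 1) (b 1)
            + 2 * overlap (f 2) (b 2) + 2 * overlap (f 3) (b 3) + 2 * overlap (f 4) (b 4)"
          "len e + r - r \<le> 2 * overlap (e 0) (w 0) + 2 * overlap (e 1) (w 1)
            + 2 * overlap (e 2) (w 2) + 2 * overlap (e 3) (w 3) + 2 * overlap (e 4) (w 4)"
          using cl[of e b] cl[of f b] cl[of e w] w Sx lb by simp_all
      qed
      then have "e x = 0" if "x < 5" "x \<noteq> 1" "x \<noteq> 4" for x
        using that e0 by (auto simp: numeral_eq_Suc less_Suc_eq)
      then show False using supp[OF e(1), of 1 4] by blast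
    next
      case 2
      have "k 2 = 0 \<and> k 4 = 0"
      proof (rule heavy_triple_aux[OF r6 rp, where bi = "a 4" and bj = "a 3" and ej = "k 3"
            and fi = "l 4" and fj = "l 3" and ti = "w 4" and tj = "w 3" and E = "len k" and F = "len l"
            and ?b0.0 = "a 0" and ?b1.0 = "a 1" and ?b2.0 = "a 2" and ?e0.0 = "k 0" and ?e1.0 = "k 1"
            and ?f0.0 = "l 0" and ?f1.0 = "l 1" and ?f2.0 = "l 2" and ?t0.0 = "w 0" and ?t1.0 = "w 1" and ?t2.0 = "w 2"])
        show "\<bar>a 0\<bar> + \<bar>a 1\<bar> + \<bar>a 2\<bar> + \<bar>a 4\<bar> + \<bar>a 3\<bar> = r - 1"
          "\<bar>k 0\<bar> + \<bar>k 1\<bar> + \<bar>k 2\<bar> + \<bar>k 4\<bar> + \<bar>k 3\<bar> = len k"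
          "\<bar>l 0\<bar> + \<bar>l 1\<bar> + \<bar>l 2\<bar> + \<bar>l 4\<bar> + \<bar>l 3\<bar> = len l"
          using la by (simp_all add: len_eq)
        show "a 2 \<le> 0" "a 3 \<le> 0" "0 < a 4" "k 0 = 0" "0 \<le> k 1" "k 4 \<le> 0"
          "l 1 \<le> 0" "l 4 \<le> 0" by fact+
        show "r - 2 \<le> 2 * a 4" using a4'(1) la ru by linarith
        show "r - 1 \<le> len k" "r - 1 \<le> len l" by fact+
        show "w 0 \<le> 0" "0 < w 4" "w 3 \<le> 0" using neg 2 by linarith+
        show "len k + (2 * p + 1) - r \<le> 2 * overlap (k 2) 1 + 2 * overlap (k 4) p + 2 * overlap (k 3) p"
          "len l + (2 * p + 1) - r \<le> 2 * overlap (l 2) 1 + 2 * overlap (l 4) p + 2 * overlap (l 3) p"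
          "r + (2 * p + 1) - r \<le> 2 * overlap (w 2) 1 + 2 * overlap (w 4) p + 2 * overlap (w 3) p"
          using clup[of k] clup[of l] clup[of w] w Sx by simp_all
        show "len k + (r - 1) - r \<le> 2 * overlap (k 0) (a 0) + 2 * overlap (k 1) (a 1)
            + 2 * overlap (k 2) (a 2) + 2 * overlap (k 4) (a 4) + 2 * overlap (k 3) (a 3)"
          "len l + (r - 1) - r \<le> 2 * overlap (l 0) (a 0) + 2 * overlap (l 1) (a 1)
            + 2 * overlap (l 2) (a 2) + 2 * overlap (l 4) (a 4) + 2 * overlap (l 3) (a 3)"
          "len k + r - r \<le> 2 * overlap (k 0) (w 0) + 2 * overlap (k 1) (w 1)
            + 2 * overlap (k 2) (w 2) + 2 * overlap (k 4) (w 4) + 2 * overlap (k 3) (w 3)"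
          using cl[of k a] cl[of l a] cl[of k w] w Sx la by simp_all
      qed
      then have "k x = 0" if "x < 5" "x \<noteq> 1" "x \<noteq> 3" for x
        using that k0 by (auto simp: numeral_eq_Suc less_Suc_eq)
      then show False using supp[OF k(1), of 1 3] by blast
    qed
  qed
qed

end

section \<open>Sign vectors and their effect on lengths\<close>

lemma len_upd:
  assumes "i < 5"
  shows "len (\<lambda>k. w k - (\<delta>(i := s)) k) = len (\<lambda>k. w k - \<delta> k) + \<bar>w i - s\<bar> - \<bar>w i - \<delta> i\<bar>"
proof -
  have "(\<Sum>k\<in>{..<5} - {i}. \<bar>w k - (\<delta>(i := s)) k\<bar>) = (\<Sum>k\<in>{..<5} - {i}. \<bar>w k - \<delta> k\<bar>)"
    by (rule sum.cong) auto
  moreover have split: "(\<Sum>k<5. f k) = f i + (\<Sum>k\<in>{..<5} - {i}. f k)" for f :: "nat \<Rightarrow> int"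
    using assms by (intro sum.remove) auto
  ultimately show ?thesis
    unfolding len_def split[of "\<lambda>k. \<bar>w k - (\<delta>(i := s)) k\<bar>"] split[of "\<lambda>k. \<bar>w k - \<delta> k\<bar>"]
    by simp
qed

lemma len_upd_le: "i < 5 \<Longrightarrow> len (\<delta>(i := s)) \<le> len \<delta> + \<bar>s\<bar>"
  using len_upd[of i "\<lambda>_. 0" \<delta> s] by (simp add: len_def)

lemma len_0 [simp]: "len (\<lambda>_. 0) = 0" by (simp add: len_def)

lemma abs_diff_unit:
  fixes a s :: int
  assumes "\<bar>s\<bar> = 1"
  shows "\<bar>a - s\<bar> = \<bar>a\<bar> + (if 0 < s * a then - 1 else 1)"
  using assms by (auto simp: abs_if split: if_splits)

lemma less_5_cases: "(i::nat) < 5 \<longleftrightarrow> i = 0 \<or> i = 1 \<or> i = 2 \<or> i = 3 \<or> i = 4"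
  by linarith

lemma lexpos_upd: "i < 5 \<Longrightarrow> lexpos ((\<lambda>_. 0)(i := 1))"
  by (auto simp: less_5_cases lexpos_def)

lemma lexpos_upd2: "i < j \<Longrightarrow> j < 5 \<Longrightarrow> lexpos ((\<lambda>_. 0)(i := 1, j := t))"
  by (auto simp: less_5_cases lexpos_def)

lemma lexpos_ex:
  assumes "lexpos w"
  shows "\<exists>k<5. 0 < w k"
proof -
  have "0 < w 0 \<or> 0 < w 1 \<or> 0 < w 2 \<or> 0 < w 3 \<or> 0 < w 4"
    using assms unfolding lexpos_def by argo
  then show ?thesis unfolding less_5_cases by blast
qed

lemma lexpos_sgn: "(\<And>k. k < 5 \<Longrightarrow> \<delta> k = sgn (w k)) \<Longrightarrow> lexpos w \<Longrightarrow> lexpos \<delta>"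
  unfolding lexpos_def by (simp add: sgn_0_0)

text \<open>The ball of radius \<open>r / 2\<close> is a clique, but it is too small for \<open>r \<le> 3\<close>.\<close>
definition moves :: "int \<Rightarrow> (nat \<Rightarrow> int) set" where
  "moves r = (if r \<le> 3
     then {(\<lambda>_. 0)(0 := 1), (\<lambda>_. 0)(1 := 1), (\<lambda>_. 0)(0 := 1, 1 := 1)} \<union> {\<delta>. r = 3 \<and> \<delta> = (\<lambda>_. 0)(2 := 1)}
     else {\<delta>. (\<forall>i\<ge>5. \<delta> i = 0) \<and> 2 * len \<delta> \<le> r})"

lemma moves_close:
  assumes "2 \<le> r" "\<delta> \<in> moves r" "\<epsilon> \<in> moves r"
  shows "len (\<lambda>i. \<delta> i - \<epsilon> i) \<le> r"
proof (cases "r \<le> 3")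
  case True
  then show ?thesis using assms by (auto simp: moves_def len_eq)
next
  case False
  have "0 \<le> overlaps \<delta> \<epsilon>" unfolding overlaps_def by (simp add: overlap_le(3))
  then show ?thesis using False assms by (auto simp: moves_def len_diff)
qed

lemma moves_len:
  assumes "2 \<le> r" "\<delta> \<in> moves r"
  shows "len \<delta> \<le> r"
proof (cases "r \<le> 3")
  case True
  then show ?thesis using assms by (auto simp: moves_def len_eq)
next
  case False
  have "0 \<le> len \<delta>" by (simp add: len_def sum_nonneg)
  then show ?thesis using False assms by (auto simp: moves_def)
qed

lemma moves_unit:
  assumes "2 \<le> r" "k < 5" "int k < r"
  shows "(\<lambda>_. 0)(k := 1) \<in> moves r"
proof (cases "r \<le> 3")
  case True
  then have "k = 0 \<or> k = 1 \<or> k = 2 \<and> r = 3" using assms by linarith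
  then show ?thesis using True by (auto simp: moves_def)
next
  case False
  then show ?thesis
    using assms len_upd_le[of k "\<lambda>_. 0" 1] by (auto simp: moves_def)
qed

section \<open>Choosing \<delta> for a given clique\<close>

context heavy
begin

text \<open>For \<open>w = v - z\<close> the bounded length is the distance from
  \<open>v - \<delta>\<close> to \<open>z\<close>, so \<open>v - \<delta>\<close> is adjacent to the
  whole clique.\<close>

definition admissible :: "(nat \<Rightarrow> int) \<Rightarrow> bool" where
  "admissible \<delta> \<longleftrightarrow> (\<forall>w\<in>S. len (\<lambda>i. w i - \<delta> i) \<le> r)"

text \<open>Keeps \<open>v - \<delta>\<close> in every box containing \<open>v\<close> and the clique.\<close>
definition in_hull :: "(nat \<Rightarrow> int) \<Rightarrow> bool" where
  "in_hull \<delta> \<longleftrightarrow> (\<forall>i. (0 < \<delta> i \<longrightarrow> (\<exists>w\<in>S. \<delta> i \<le> w i)) \<and> (\<delta> i < 0 \<longrightarrow> (\<exists>w\<in>S. w i \<le> \<delta> i)))"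

lemma admissible_single:
  assumes "i < 5" "\<bar>s\<bar> = 1" and hit: "\<And>w. w \<in> S \<Longrightarrow> len w = r \<Longrightarrow> 0 < s * w i"
  shows "admissible ((\<lambda>_. 0)(i := s))"
  unfolding admissible_def
proof
  fix w assume w: "w \<in> S"
  have eq: "len (\<lambda>k. w k - ((\<lambda>_. 0)(i := s)) k) = len w + (if 0 < s * w i then - 1 else 1)"
    using abs_diff_unit[OF assms(2), of "w i"] unfolding len_upd[OF assms(1)] by simp
  have gen: "l + (if A then - 1 else 1) \<le> r" if "l \<le> r" "l = r \<Longrightarrow> A" for l A
    using that by (cases "l = r") auto
  show "len (\<lambda>k. w k - ((\<lambda>_. 0)(i := s)) k) \<le> r"
    unfolding eq by (rule gen[OF bound[OF w] hit[OF w]])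
qed

text \<open>A vector of length at most \<open>r - 2\<close> can afford two misses; for a longer one
  the guaranteed hit offsets a miss in the other coordinate.\<close>

lemma admissible_pair:
  assumes "i < 5" "j < 5" "i \<noteq> j" "\<bar>s\<bar> = 1" "\<bar>t\<bar> = 1"
    and hit: "\<And>w. w \<in> hv \<Longrightarrow> 0 < s * w i \<or> 0 < t * w j"
  shows "admissible ((\<lambda>_. 0)(i := s, j := t))"
  unfolding admissible_def
proof
  fix w assume w: "w \<in> S"
  have "len (\<lambda>k. w k - ((\<lambda>_. 0)(i := s, j := t)) k) = len w + (\<bar>w i - s\<bar> - \<bar>w i\<bar>) + (\<bar>w j - t\<bar> - \<bar>w j\<bar>)"
    using assms(3) unfolding len_upd[OF assms(1)] len_upd[OF assms(2)] by simp
  also have "\<dots> = len w + (if 0 < s * w i then - 1 else 1) + (if 0 < t * w j then - 1 else 1)"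
    unfolding abs_diff_unit[OF assms(4), of "w i"] abs_diff_unit[OF assms(5), of "w j"] by linarith
  also have "\<dots> \<le> r"
  proof -
    have gen: "l + (if A then - 1 else 1) + (if B then - 1 else 1) \<le> r"
      if "l \<le> r" "r - 1 \<le> l \<Longrightarrow> A \<or> B" for l A B
      using that by (cases "r - 1 \<le> l") auto
    have "r - 1 \<le> len w \<Longrightarrow> w \<in> hv" using w by (simp add: hv_def)
    from gen[OF bound[OF w] hit[OF this]] show ?thesis .
  qed
  finally show "len (\<lambda>k. w k - ((\<lambda>_. 0)(i := s, j := t)) k) \<le> r" .
qed

text \<open>The change of length is odd, so one hit suffices at lengths \<open>r - 2\<close> and
  \<open>r - 1\<close>, and two at length \<open>r\<close>. Coordinates \<open>j\<close>,
  \<open>k\<close> supply the first hit; the second comes from \<open>i\<close> or from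
  \<open>j\<close> and \<open>k\<close> both hitting.\<close>

lemma admissible_triple:
  assumes "i < 5" "j < 5" "k < 5" "i \<noteq> j" "i \<noteq> k" "j \<noteq> k" "\<bar>s\<bar> = 1" "\<bar>t\<bar> = 1"
    and one: "\<And>w. w \<in> S \<Longrightarrow> r - 2 \<le> len w \<Longrightarrow> 0 < s * w j \<or> 0 < t * w k"
    and two: "\<And>w. w \<in> S \<Longrightarrow> len w = r \<Longrightarrow> 0 < w i \<or> 0 < s * w j \<and> 0 < t * w k"
  shows "admissible ((\<lambda>_. 0)(i := 1, j := s, k := t))"
  unfolding admissible_def
proof
  fix w assume w: "w \<in> S"
  have "len (\<lambda>l. w l - ((\<lambda>_. 0)(i := 1, j := s, k := t)) l)
      = len w + (\<bar>w i - 1\<bar> - \<bar>w i\<bar>) + (\<bar>w j - s\<bar> - \<bar>w j\<bar>) + (\<bar>w k - t\<bar> - \<bar>w k\<bar>)"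
    using assms(4-6) unfolding len_upd[OF assms(1)] len_upd[OF assms(2)] len_upd[OF assms(3)] by simp
  also have "\<dots> = len w + (if 0 < w i then - 1 else 1) + (if 0 < s * w j then - 1 else 1)
      + (if 0 < t * w k then - 1 else 1)"
    unfolding abs_diff_unit[OF assms(7), of "w j"] abs_diff_unit[OF assms(8), of "w k"]
    using abs_diff_unit[of 1 "w i"] by simp
  also have "\<dots> \<le> r"
  proof -
    have gen: "l + (if A then - 1 else 1) + (if B then - 1 else 1) + (if C then - 1 else 1) \<le> r"
      if "l \<le> r" "r - 2 \<le> l \<Longrightarrow> B \<or> C" "l = r \<Longrightarrow> A \<or> B \<and> C" for l A B C
      using that by (cases "r - 2 \<le> l"; cases "l = r") auto
    show ?thesis by (rule gen[OF bound[OF w] one[OF w] two[OF w]])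
  qed
  finally show "len (\<lambda>l. w l - ((\<lambda>_. 0)(i := 1, j := s, k := t)) l) \<le> r" .
qed

lemma in_hull_upd:
  assumes "in_hull \<delta>" "w \<in> S" "\<bar>s\<bar> = 1" "0 < s * w i"
  shows "in_hull (\<delta>(i := s))"
proof -
  have "s = 1 \<and> 1 \<le> w i \<or> s = - 1 \<and> w i \<le> - 1" using assms(3,4) by (auto simp: abs_if split: if_splits)
  then show ?thesis using assms(1,2) unfolding in_hull_def by auto
qed

lemma in_hull_0: "in_hull (\<lambda>_. 0)" by (simp add: in_hull_def)

text \<open>Three outcomes occur because \<open>in_hull\<close> permits an entry 1 only where some
  member of \<open>S\<close> is positive. If none is positive at \<open>j\<close>, all heavy vectors
  are positive at \<open>i\<close>, and that coordinate alone suffices.\<close>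

lemma positive_pair:
  assumes ij: "i < 5" "j < 5" "i \<noteq> j" and ne: "hv \<noteq> {}"
    and hit: "\<And>w. w \<in> hv \<Longrightarrow> 0 < w i \<or> 0 < w j"
  shows "\<exists>\<delta>\<in>{(\<lambda>_. 0)(i := 1), (\<lambda>_. 0)(j := 1), (\<lambda>_. 0)(i := 1, j := 1)}. in_hull \<delta> \<and> admissible \<delta>"
proof -
  have hvS: "hv \<subseteq> S" by (auto simp: hv_def)
  have tight: "w \<in> hv" if "w \<in> S" "len w = r" for w using that by (simp add: hv_def)
  consider w x where "w \<in> S" "0 < w i" "x \<in> S" "0 < x j"
    | w where "w \<in> S" "0 < w i" "\<And>x. x \<in> S \<Longrightarrow> \<not> 0 < x j"
    | w where "w \<in> S" "0 < w j" "\<And>x. x \<in> S \<Longrightarrow> \<not> 0 < x i"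
    using ne hit hvS by blast
  then show ?thesis
  proof cases
    case 1
    then have "in_hull ((\<lambda>_. 0)(i := 1, j := 1))"
      by (intro in_hull_upd[of _ x] in_hull_upd[of _ w] in_hull_0) auto
    moreover have "admissible ((\<lambda>_. 0)(i := 1, j := 1))"
      using hit by (intro admissible_pair ij) auto
    ultimately show ?thesis by blast
  next
    case 2
    then have "in_hull ((\<lambda>_. 0)(i := 1))" by (intro in_hull_upd[of _ w] in_hull_0) auto
    moreover have "admissible ((\<lambda>_. 0)(i := 1))"
      using hit[OF tight] 2(3) by (intro admissible_single ij) auto
    ultimately show ?thesis by blast
  next
    case 3
    then have "in_hull ((\<lambda>_. 0)(j := 1))" by (intro in_hull_upd[of _ w] in_hull_0) auto
    moreover have "admissible ((\<lambda>_. 0)(j := 1))"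
      using hit[OF tight] 3(3) by (intro admissible_single ij) auto
    ultimately show ?thesis by blast
  qed
qed

text \<open>Heavy vectors have at least three nonzero entries, so the first one is at 0, 1 or 2 and
  is positive. Coordinates 1, 2 or 0, 1 work unless some heavy \<open>u\<close> is supported exactly
  on 2, 3, 4; this \<open>u\<close> then determines which signs to try at 3 and 4.\<close>

lemma exists_admissible_generic:
  assumes r: "4 \<le> r" and ne: "hv \<noteq> {}"
    and lex: "\<And>w. w \<in> S \<Longrightarrow> lexpos w"
    and zero: "\<And>w i. w \<in> S \<Longrightarrow> r \<le> int i \<Longrightarrow> w i = 0"
    and supp: "\<And>w i j. w \<in> hv \<Longrightarrow> \<exists>k<5. k \<noteq> i \<and> k \<noteq> j \<and> w k \<noteq> 0"
  shows "\<exists>\<delta>\<in>moves r. lexpos \<delta> \<and> in_hull \<delta> \<and> admissible \<delta>"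
proof -
  have hvS: "w \<in> S" if "w \<in> hv" for w using that by (simp add: hv_def)
  have lex': "0 < w 0 \<or> w 0 = 0 \<and> (0 < w 1 \<or> w 1 = 0 \<and> 0 < w 2)" if "w \<in> hv" for w
    using lex[OF hvS[OF that]] supp[OF that, of 3 4] unfolding lexpos_def less_5_cases by auto
  have moves1: "(\<lambda>_. 0)(i := s) \<in> moves r" if "i < 5" "\<bar>s\<bar> = 1" for i s
    using r that len_upd_le[of i "\<lambda>_. 0" s] by (auto simp: moves_def)
  have moves2: "(\<lambda>_. 0)(i := s, j := t) \<in> moves r" if "i < 5" "j < 5" "\<bar>s\<bar> = 1" "\<bar>t\<bar> = 1" for i j s t
    using r that len_upd_le[of i "\<lambda>_. 0" s] len_upd_le[of j "(\<lambda>_. 0)(i := s)" t]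
    by (auto simp: moves_def)
  have positive: ?thesis
    if ij: "i < j" "j < 5" and hit: "\<And>w. w \<in> hv \<Longrightarrow> 0 < w i \<or> 0 < w j" for i j
  proof -
    have i5: "i < 5" using ij by simp
    obtain \<delta> where \<delta>: "\<delta> \<in> {(\<lambda>_. 0)(i := 1), (\<lambda>_. 0)(j := 1), (\<lambda>_. 0)(i := 1, j := 1)}"
      "in_hull \<delta>" "admissible \<delta>"
      using positive_pair[OF i5 ij(2) _ ne hit] ij(1) by blast
    moreover have "lexpos \<delta>"
      using \<delta>(1) lexpos_upd[OF i5] lexpos_upd[OF ij(2)] lexpos_upd2[OF ij] by blast
    moreover have "\<delta> \<in> moves r"
      using \<delta>(1) moves1[OF i5, of 1] moves1[OF ij(2), of 1] moves2[OF i5 ij(2), of 1 1] by auto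
    ultimately show ?thesis by blast
  qed
  show ?thesis
  proof (cases "\<exists>w\<in>hv. 0 < w 0")
    case False
    have "0 < w 1 \<or> 0 < w 2" if "w \<in> hv" for w using lex'[OF that] False that by blast
    then show ?thesis by (intro positive[of 1 2]) auto
  next
    case True
    then obtain w0 where w0: "w0 \<in> S" "0 < w0 0" using hvS by blast
    show ?thesis
    proof (cases "\<exists>u\<in>hv. u 0 = 0 \<and> u 1 = 0")
      case False
      have "0 < w 0 \<or> 0 < w 1" if "w \<in> hv" for w using lex'[OF that] False that by blast
      then show ?thesis by (intro positive[of 0 1]) auto
    next
      case True
      then obtain u where u: "u \<in> hv" "u 0 = 0" "u 1 = 0" by blast
      have uS: "u \<in> S" using hvS[OF u(1)] .
      have u2: "0 < u 2" using lex'[OF u(1)] u by simp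
      have u34: "u 3 \<noteq> 0" "u 4 \<noteq> 0"
        using supp[OF u(1), of 2 3] supp[OF u(1), of 2 4] u unfolding less_5_cases by auto
      have r5: "5 \<le> r"
      proof (rule ccontr)
        assume "\<not> 5 \<le> r"
        then have "u 4 = 0" using zero[OF uS, of 4] by simp
        then show False using u34 by simp
      qed
      have pair: ?thesis
        if "i < j" "j < 5" "\<bar>t\<bar> = 1" and hit: "\<And>w. w \<in> hv \<Longrightarrow> 0 < w i \<or> 0 < t * w j"
          and w: "w \<in> S" "0 < w i" and x: "x \<in> S" "0 < t * x j" for i j t w x
      proof -
        have "in_hull ((\<lambda>_. 0)(i := 1, j := t))"
          using that by (intro in_hull_upd[of _ x] in_hull_upd[of _ w] in_hull_0) auto
        moreover have "admissible ((\<lambda>_. 0)(i := 1, j := t))"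
          using that by (intro admissible_pair) auto
        moreover have "(\<lambda>_. 0)(i := 1, j := t) \<in> moves r" using that by (intro moves2) auto
        moreover have "lexpos ((\<lambda>_. 0)(i := 1, j := t))" using that by (intro lexpos_upd2) auto
        ultimately show ?thesis by blast
      qed
      show ?thesis
      proof (cases "\<forall>w\<in>hv. 0 < w 0 \<or> 0 < w 2")
        case True
        then show ?thesis using w0 uS u2 by (intro pair[of 0 2 1 w0 u]) auto
      next
        case False
        then obtain w1 where "w1 \<in> hv" "\<not> 0 < w1 0" "\<not> 0 < w1 2" by blast
        then have w1: "w1 \<in> S" "0 < w1 1" using lex'[of w1] hvS by auto
        \<comment> \<open>Flipping signs at 3 and 4 makes \<open>u\<close> positive there; lengths
          and overlaps are unchanged, so the flipped set is again a \<open>heavy\<close>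
          family.\<close>
        define c where "c = (\<lambda>k. if k = 3 then sgn (u 3) else if k = (4::nat) then sgn (u 4) else 1)"
        have c1: "\<bar>c k\<bar> = 1" for k using u34 by (auto simp: c_def abs_sgn_eq)
        have c2: "c k = 1 \<or> c k = - 1" for k using c1[of k] by linarith
        have cu: "0 < c 3 * u 3" "0 < c 4 * u 4" using u34 by (auto simp: c_def sgn_if)
        define F where "F = (\<lambda>w k. c k * w k :: int)"
        have lenF: "len (F w) = len w" for w by (simp add: F_def len_def abs_mult c1)
        have overlapF: "overlaps (F x) (F y) = overlaps x y" for x y
        proof -
          have "overlap (c k * a) (c k * b) = overlap a b" for k a b
            using c2[of k] by (auto simp: overlap_def)
          then show ?thesis by (simp add: overlaps_def F_def)
        qed
        interpret F: heavy "F ` S" r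
          by unfold_locales (auto simp: lenF overlapF bound close)
        have hvF: "F.hv = F ` hv" by (auto simp: F.hv_def hv_def lenF)
        let ?P = "{(2,3),(2,4),(0,3),(0,4),(1,3),(1::nat,4::nat)}"
        show ?thesis
        proof (cases "\<forall>(i, j)\<in>?P. \<exists>w\<in>F.hv. w i \<le> 0 \<and> w j \<le> 0")
          case False
          then obtain i j where ij: "(i, j) \<in> ?P" "\<And>w. w \<in> F.hv \<Longrightarrow> \<not> (w i \<le> 0 \<and> w j \<le> 0)" by blast
          have i: "i = 0 \<or> i = 1 \<or> i = 2" and j: "j = 3 \<or> j = 4" using ij(1) by auto
          have ci: "c i = 1" using i by (auto simp: c_def)
          have hit: "0 < w i \<or> 0 < c j * w j" if "w \<in> hv" for w
          proof -
            have "F w \<in> F.hv" using that by (simp add: hvF)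
            then have "\<not> (F w i \<le> 0 \<and> F w j \<le> 0)" by (rule ij(2))
            then show ?thesis using ci by (simp add: F_def not_le)
          qed
          \<comment> \<open>As \<open>in_hull\<close> requires, coordinates 0, 1, 2 are positive in
            \<open>w0\<close>, \<open>w1\<close>, \<open>u\<close> respectively.\<close>
          obtain w where w: "w \<in> S" "0 < w i" using i w0 w1 uS u2 by blast
          have cuj: "0 < c j * u j" using j cu by auto
          have ij5: "i < j" "j < 5" using i j by auto
          show ?thesis by (rule pair[OF ij5 c1 hit w uS cuj])
        next
          case True
          have lexF: "0 < w 0 \<or> w 0 = 0 \<and> (0 < w 1 \<or> w 1 = 0 \<and> 0 < w 2)" if wF: "w \<in> F.hv" for w
          proof -
            obtain x where x: "x \<in> hv" "w = F x" using wF unfolding hvF by blast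
            then show ?thesis using lex'[OF x(1)] by (simp add: F_def c_def)
          qed
          have suppF: "\<exists>k<5. k \<noteq> i \<and> k \<noteq> j \<and> w k \<noteq> 0" if wF: "w \<in> F.hv" for w i j
          proof -
            obtain x where x: "x \<in> hv" "w = F x" using wF unfolding hvF by blast
            obtain k where "k < 5" "k \<noteq> i" "k \<noteq> j" "x k \<noteq> 0" using supp[OF x(1)] by blast
            moreover have "c k \<noteq> 0" using c1[of k] by auto
            ultimately show ?thesis using x(2) by (auto simp: F_def)
          qed
          have uF: "F u \<in> F.hv" "F u 0 = 0" "F u 1 = 0" "0 < F u 2" "0 < F u 3" "0 < F u 4"
            using u u2 cu by (simp_all add: hvF) (simp_all add: F_def c_def)
          have pF: "\<exists>w\<in>F.hv. w i \<le> 0 \<and> w j \<le> 0" if "(i, j) \<in> ?P" for i j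
            using True that by blast
          note deep = F.no_hitting_pair[OF r5 lexF suppF uF pF]
          have "admissible ((\<lambda>_. 0)(0 := 1, 3 := c 3, 4 := c 4))"
          proof (rule admissible_triple)
            show "0 < c 3 * w 3 \<or> 0 < c 4 * w 4" if "w \<in> S" "r - 2 \<le> len w" for w
              using deep(2)[of "F w"] that by (simp add: lenF) (simp add: F_def)
            show "0 < w 0 \<or> 0 < c 3 * w 3 \<and> 0 < c 4 * w 4" if "w \<in> S" "len w = r" for w
              using deep(3)[of "F w"] that by (simp add: lenF) (simp add: F_def c_def)
          qed (simp_all add: c1)
          moreover have "in_hull ((\<lambda>_. 0)(0 := 1, 3 := c 3, 4 := c 4))"
            using w0 uS c1 cu by (intro in_hull_upd[of _ u] in_hull_upd[of _ w0] in_hull_0) auto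
          moreover have "lexpos ((\<lambda>_. 0)(0 := 1, 3 := c 3, 4 := c 4))" by (simp add: lexpos_def)
          \<comment> \<open>Length 3 fits into the ball of radius \<open>r / 2\<close> because
            \<open>r = 5\<close> has been excluded.\<close>
          moreover have "len ((\<lambda>_. 0)(0 := 1, 3 := c 3, 4 := c 4)) = 3" by (simp add: len_eq c1)
          then have "(\<lambda>_. 0)(0 := 1, 3 := c 3, 4 := c 4) \<in> moves r"
            using deep(1) by (simp add: moves_def)
          ultimately show ?thesis by blast
        qed
      qed
    qed
  qed
qed

lemma overlaps_posE:
  assumes "0 < overlaps x y"
  obtains k where "k < 5" "0 < sgn (y k) * x k"
proof -
  have "\<exists>k<5. 0 < overlap (x k) (y k)"
  proof (rule ccontr)
    assume "\<not> ?thesis"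
    then have "overlap (x k) (y k) \<le> 0" if "k < 5" for k using that by force
    from this[of 0] this[of 1] this[of 2] this[of 3] this[of 4] show False
      using assms unfolding overlaps_def by simp
  qed
  then obtain k where "k < 5" "0 < x k * y k" by (auto simp: overlap_pos_iff)
  then show thesis using that by (auto simp: zero_less_mult_iff sgn_if)
qed

text \<open>Every heavy vector overlaps the heavy \<open>w\<close>, hence agrees in sign with it at
  one of its at most two nonzero coordinates. The sign vector of \<open>w\<close> can therefore be
  subtracted.\<close>

lemma exists_admissible_short:
  assumes r: "4 \<le> r" and lex: "\<And>w. w \<in> S \<Longrightarrow> lexpos w"
    and w: "w \<in> hv" "\<And>k. k < 5 \<Longrightarrow> k \<noteq> i \<Longrightarrow> k \<noteq> j \<Longrightarrow> w k = 0"
  shows "\<exists>\<delta>\<in>moves r. lexpos \<delta> \<and> in_hull \<delta> \<and> admissible \<delta>"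
proof -
  have wS: "w \<in> S" using w(1) by (simp add: hv_def)
  obtain a where a: "a < 5" "w a \<noteq> 0" using lexpos_ex[OF lex[OF wS]] by force
  obtain b where b: "b < 5" "b \<noteq> a" "\<And>k. k < 5 \<Longrightarrow> k \<noteq> a \<Longrightarrow> k \<noteq> b \<Longrightarrow> w k = 0"
  proof (cases "\<exists>b<5. b \<noteq> a \<and> w b \<noteq> 0")
    case True
    then obtain b where b: "b < 5" "b \<noteq> a" "w b \<noteq> 0" by blast
    have "k = i \<or> k = j" if "k < 5" "w k \<noteq> 0" for k using w(2) that by blast
    from this[OF a] this[OF b(1,3)] have "i = a \<and> j = b \<or> i = b \<and> j = a" using b(2) by metis
    then show ?thesis using that[of b] b(1,2) w(2) by metis
  next
    case False
    \<comment> \<open>Any second index will do: \<open>w\<close> vanishes there, and its sign 0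
      yields no hit.\<close>
    define b :: nat where "b = (if a = 0 then 1 else 0)"
    have "b < 5" "b \<noteq> a" by (simp_all add: b_def)
    moreover have "w k = 0" if "k < 5" "k \<noteq> a" for k using False that by blast
    ultimately show ?thesis using that[of b] by blast
  qed
  have hit: "0 < sgn (w a) * x a \<or> 0 < sgn (w b) * x b" if x: "x \<in> hv" for x
  proof -
    have "0 < overlaps x w" using close[of x w] x w(1) r by (auto simp: hv_def)
    then obtain k where k: "k < 5" "0 < sgn (w k) * x k" by (rule overlaps_posE)
    then have "w k \<noteq> 0" by auto
    then have "k = a \<or> k = b" using b(3) k(1) by blast
    then show ?thesis using k(2) by auto
  qed
  have sgn: "\<bar>sgn z\<bar> = 1" "0 < sgn z * z" if "z \<noteq> 0" for z :: int
    using that by (auto simp: sgn_if)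
  have sa: "\<bar>sgn (w a)\<bar> = 1" "0 < sgn (w a) * w a" using sgn[OF a(2)] .
  show ?thesis
  proof (cases "w b = 0")
    case True
    let ?d = "(\<lambda>_. 0)(a := sgn (w a))"
    have "?d k = sgn (w k)" if "k < 5" for k
      using b(3)[OF that] True by (cases "k = a"; cases "k = b") simp_all
    then have "lexpos ?d" using lex[OF wS] by (rule lexpos_sgn)
    moreover have "in_hull ?d" by (rule in_hull_upd[OF in_hull_0 wS sa])
    moreover have "admissible ?d"
      using hit True by (intro admissible_single a sa) (auto simp: hv_def)
    moreover have "?d \<in> moves r"
      using r a sa(1) len_upd_le[OF a(1), of "\<lambda>_. 0" "sgn (w a)"] by (auto simp: moves_def)
    ultimately show ?thesis by blast
  next
    case False
    let ?d = "(\<lambda>_. 0)(a := sgn (w a), b := sgn (w b))"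
    have sb: "\<bar>sgn (w b)\<bar> = 1" "0 < sgn (w b) * w b" using sgn[OF False] .
    have "?d k = sgn (w k)" if "k < 5" for k
      using b(3)[OF that] by (cases "k = a"; cases "k = b") simp_all
    then have "lexpos ?d" using lex[OF wS] by (rule lexpos_sgn)
    moreover have "in_hull ?d" by (rule in_hull_upd[OF in_hull_upd[OF in_hull_0 wS sa] wS sb])
    moreover have "admissible ?d"
      using hit b(2) by (intro admissible_pair a b sa sb) auto
    moreover have "?d \<in> moves r"
      using r a b sa(1) sb(1) len_upd_le[OF a(1), of "\<lambda>_. 0" "sgn (w a)"]
        len_upd_le[OF b(1), of "(\<lambda>_. 0)(a := sgn (w a))" "sgn (w b)"] by (auto simp: moves_def)
    ultimately show ?thesis by blast
  qed
qed

text \<open>Only coordinates below \<open>r\<close> can be nonzero. Either coordinates 0, 1 hit all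
  heavy vectors, or some heavy \<open>u\<close> lives on coordinate 2 alone; then
  \<open>r = 3\<close>, and every vector of length 3 overlaps \<open>u\<close>.\<close>

lemma exists_admissible_small:
  assumes r: "2 \<le> r" "r \<le> 3" and ne: "hv \<noteq> {}"
    and lex: "\<And>w. w \<in> S \<Longrightarrow> lexpos w"
    and zero: "\<And>w i. w \<in> S \<Longrightarrow> r \<le> int i \<Longrightarrow> w i = 0"
  shows "\<exists>\<delta>\<in>moves r. lexpos \<delta> \<and> in_hull \<delta> \<and> admissible \<delta>"
proof (cases "\<exists>u\<in>hv. u 0 = 0 \<and> u 1 = 0")
  case True
  then obtain u where u: "u \<in> S" "r - 1 \<le> len u" "u 0 = 0" "u 1 = 0" by (auto simp: hv_def)
  have u34: "u 3 = 0" "u 4 = 0" using zero[OF u(1), of 3] zero[OF u(1), of 4] r by simp_all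
  then have u2: "0 < u 2" using lex[OF u(1)] u unfolding lexpos_def by simp
  have r3: "r = 3" using zero[OF u(1), of 2] r u2 by (cases "r = 2") auto
  have "0 < w 2" if "w \<in> S" "len w = r" for w
  proof -
    have "overlaps w u = overlap (w 2) (u 2)" using u u34 by (simp add: overlaps_def overlap_def)
    then have "0 < overlap (w 2) (u 2)" using close[OF that(1) u(1)] that(2) u(2) r3 by linarith
    then show ?thesis using u2 by (simp add: overlap_pos_iff zero_less_mult_iff)
  qed
  then have "admissible ((\<lambda>_. 0)(2 := 1))" by (intro admissible_single) auto
  moreover have "in_hull ((\<lambda>_. 0)(2 := 1))"
    using u2 by (intro in_hull_upd[OF in_hull_0 u(1)]) auto
  moreover have "(\<lambda>_. 0)(2 := 1) \<in> moves r" using r3 by (simp add: moves_def)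
  ultimately show ?thesis using lexpos_upd[of 2] by auto
next
  case False
  have "0 < w 0 \<or> 0 < w 1" if w: "w \<in> hv" for w
    using lex[of w] False w by (auto simp: hv_def lexpos_def)
  then obtain \<delta> where \<delta>: "\<delta> \<in> {(\<lambda>_. 0)(0 := 1), (\<lambda>_. 0)(1 := 1), (\<lambda>_. 0)(0 := 1, 1 := 1)}"
      "in_hull \<delta>" "admissible \<delta>"
    using positive_pair[of 0 1] ne by auto
  moreover have "lexpos \<delta>"
    using \<delta>(1) lexpos_upd[of 0] lexpos_upd[of 1] lexpos_upd2[of 0 1 1] by auto
  moreover have "\<delta> \<in> moves r" using \<delta>(1) r by (auto simp: moves_def)
  ultimately show ?thesis by blast
qed

theorem exists_admissible:
  assumes r: "2 \<le> r" and ne: "S \<noteq> {}"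
    and lex: "\<And>w. w \<in> S \<Longrightarrow> lexpos w"
    and zero: "\<And>w i. w \<in> S \<Longrightarrow> r \<le> int i \<Longrightarrow> w i = 0"
  shows "\<exists>\<delta>\<in>moves r. lexpos \<delta> \<and> in_hull \<delta> \<and> admissible \<delta>"
proof (cases "hv = {}")
  case True
  obtain w where w: "w \<in> S" using ne by blast
  obtain k where k: "k < 5" "0 < w k" using lexpos_ex[OF lex[OF w]] by blast
  have kr: "int k < r" using zero[OF w, of k] k by (cases "int k < r") auto
  \<comment> \<open>Without heavy vectors a unit step cannot exceed \<open>r\<close>, so it only has
    to point towards a member of the clique.\<close>
  have "admissible ((\<lambda>_. 0)(k := 1))"
    using True k by (intro admissible_single) (auto simp: hv_def)
  moreover have "in_hull ((\<lambda>_. 0)(k := 1))"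
    using k by (intro in_hull_upd[OF in_hull_0 w]) auto
  moreover have "(\<lambda>_. 0)(k := 1) \<in> moves r" by (rule moves_unit[OF r k(1) kr])
  ultimately show ?thesis using lexpos_upd[OF k(1)] by blast
next
  case ne': False
  show ?thesis
  proof (cases "r \<le> 3")
    case True
    then show ?thesis using r ne' lex zero by (intro exists_admissible_small)
  next
    case False
    then have r4: "4 \<le> r" by simp
    show ?thesis
    proof (cases "\<forall>w\<in>hv. \<forall>i j. \<exists>k<5. k \<noteq> i \<and> k \<noteq> j \<and> w k \<noteq> 0")
      case True
      then show ?thesis using r4 ne' lex zero by (intro exists_admissible_generic) blast+
    next
      case False
      then obtain w i j where w: "w \<in> hv" "\<And>k. k < 5 \<Longrightarrow> k \<noteq> i \<Longrightarrow> k \<noteq> j \<Longrightarrow> w k = 0" by blast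
      show ?thesis by (rule exists_admissible_short[OF r4 lex w])
    qed
  qed
qed

end

section \<open>The lattice\<close>

lemma lexpos_add: "lexpos x \<Longrightarrow> lexpos y \<Longrightarrow> lexpos (\<lambda>k. x k + y k)"
  unfolding lexpos_def by linarith
lemma lexpos_asym: "lexpos x \<Longrightarrow> \<not> lexpos (\<lambda>k. - x k)"
  unfolding lexpos_def by linarith
lemma lexpos_total: "k < 5 \<Longrightarrow> x k \<noteq> 0 \<Longrightarrow> lexpos x \<or> lexpos (\<lambda>k. - x k)"
  unfolding lexpos_def less_5_cases by (elim disjE; simp; linarith)
definition lattice_box :: "int \<Rightarrow> (int ^ 'n) set" where
  "lattice_box m = {v. \<forall>i. \<bar>v $ i\<bar> \<le> m}"

lemma finite_lattice_box: "finite (lattice_box m :: (int ^ 'n::finite) set)"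
proof (rule finite_subset)
  show "lattice_box m \<subseteq> (\<lambda>f. \<chi> i. f i) ` (UNIV \<rightarrow>\<^sub>E {- m..m} :: ('n \<Rightarrow> int) set)"
  proof
    fix v :: "int ^ 'n" assume "v \<in> lattice_box m"
    then have "($) v \<in> UNIV \<rightarrow>\<^sub>E {- m..m}" by (auto simp: lattice_box_def abs_le_iff minus_le_iff)
    moreover have "v = (\<chi> i. v $ i)" by (simp add: vec_eq_iff)
    ultimately show "v \<in> (\<lambda>f. \<chi> i. f i) ` (UNIV \<rightarrow>\<^sub>E {- m..m} :: ('n \<Rightarrow> int) set)" by blast
  qed
  show "finite ((\<lambda>f. \<chi> i. f i) ` (UNIV \<rightarrow>\<^sub>E {- m..m} :: ('n \<Rightarrow> int) set))"
    by (intro finite_imageI finite_PiE) auto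
qed

lemma component_le_manhattan: "\<bar>x $ i - y $ i\<bar> \<le> manhattan x y"
  unfolding manhattan_def by (rule member_le_sum[of i UNIV "\<lambda>i. \<bar>x $ i - y $ i\<bar>"]) auto

lemma rips_manhattan: "0 \<le> r \<Longrightarrow> rips manhattan r"
  by unfold_locales (simp_all add: manhattan_def abs_minus_commute)

section \<open>Transfer from \<open>int ^ 'n\<close> to padded vectors\<close>

locale enumerated =
  fixes e :: "nat \<Rightarrow> 'n::finite"
  assumes bij: "bij_betw e {..<CARD('n)} UNIV" and card_le: "CARD('n) \<le> 5"
begin

definition coord :: "int ^ 'n \<Rightarrow> nat \<Rightarrow> int" where
  "coord v k = (if k < CARD('n) then v $ e k else 0)"

definition shift :: "int ^ 'n \<Rightarrow> (nat \<Rightarrow> int) \<Rightarrow> int ^ 'n" where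
  "shift v \<delta> = (\<chi> i. v $ i - \<delta> (the_inv_into {..<CARD('n)} e i))"

lemma index_ex: "\<exists>k<CARD('n). i = e k"
  using bij unfolding bij_betw_def by (metis UNIV_I imageE lessThan_iff)

lemma coord_shift:
  assumes "\<And>k. CARD('n) \<le> k \<Longrightarrow> \<delta> k = 0"
  shows "coord (shift v \<delta>) k = coord v k - \<delta> k"
proof (cases "k < CARD('n)")
  case True
  then have "the_inv_into {..<CARD('n)} e (e k) = k"
    using bij by (intro the_inv_into_f_f) (auto simp: bij_betw_def)
  then show ?thesis using True by (simp add: coord_def shift_def)
qed (use assms in \<open>simp add: coord_def\<close>)

lemma manhattan_eq: "manhattan x y = len (\<lambda>k. coord x k - coord y k)"
proof -
  have "manhattan x y = (\<Sum>k<CARD('n). \<bar>x $ e k - y $ e k\<bar>)"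
    unfolding manhattan_def by (rule sum.reindex_bij_betw[OF bij, symmetric])
  also have "\<dots> = (\<Sum>k<CARD('n). \<bar>coord x k - coord y k\<bar>)"
    by (rule sum.cong) (simp_all add: coord_def)
  also have "\<dots> = (\<Sum>k<5. \<bar>coord x k - coord y k\<bar>)"
    using card_le by (intro sum.mono_neutral_left) (auto simp: coord_def)
  finally show ?thesis by (simp add: len_def)
qed

definition below :: "int ^ 'n \<Rightarrow> int ^ 'n \<Rightarrow> bool" where
  "below z v \<longleftrightarrow> lexpos (\<lambda>k. coord v k - coord z k)"

lemma transp_below: "transp_on A below"
proof (rule transp_onI)
  fix x y z assume "below x y" "below y z"
  then show "below x z" using lexpos_add unfolding below_def by fastforce
qed

lemma asymp_below: "asymp_on A below"
proof (rule asymp_onI)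
  fix x y assume "below x y"
  then show "\<not> below y x" using lexpos_asym unfolding below_def by fastforce
qed

lemma totalp_below: "totalp_on A below"
proof (rule totalp_onI)
  fix x y :: "int ^ 'n" assume "x \<noteq> y"
  then obtain k where k: "k < CARD('n)" "x $ e k \<noteq> y $ e k"
    using index_ex by (metis vec_eq_iff)
  then have "k < 5" "coord y k - coord x k \<noteq> 0" using card_le by (auto simp: coord_def)
  then show "below x y \<or> below y x"
    using lexpos_total[of k "\<lambda>k. coord y k - coord x k"] by (simp add: below_def)
qed

text \<open>Each coordinate of \<open>v - \<delta>\<close> lies between that of \<open>v\<close> and
  that of some point of the box.\<close>

lemma shift_in_lattice_box:
  assumes "v \<in> lattice_box m"
    and "\<And>k. CARD('n) \<le> k \<Longrightarrow> \<delta> k = 0"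
    and "\<And>k. 0 < \<delta> k \<Longrightarrow> \<exists>z\<in>lattice_box m. \<delta> k \<le> coord v k - coord z k"
    and "\<And>k. \<delta> k < 0 \<Longrightarrow> \<exists>z\<in>lattice_box m. coord v k - coord z k \<le> \<delta> k"
  shows "shift v \<delta> \<in> lattice_box m"
  unfolding lattice_box_def
proof (intro CollectI allI)
  fix i
  obtain k where k: "k < CARD('n)" "i = e k" using index_ex by blast
  have c: "coord x k = x $ i" for x using k by (simp add: coord_def)
  have b: "\<bar>x $ i\<bar> \<le> m" if "x \<in> lattice_box m" for x using that by (simp add: lattice_box_def)
  have s: "shift v \<delta> $ i = v $ i - \<delta> k" using coord_shift[of \<delta> v k] assms(2) by (simp add: c)
  consider "\<delta> k = 0" | "0 < \<delta> k" | "\<delta> k < 0" by linarith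
  then show "\<bar>shift v \<delta> $ i\<bar> \<le> m"
  proof cases
    case 1
    then show ?thesis using s b[OF assms(1)] by simp
  next
    case 2
    then obtain z where "z \<in> lattice_box m" "\<delta> k \<le> v $ i - z $ i" using assms(3)[of k] by (auto simp: c)
    then show ?thesis using 2 s b[OF assms(1)] b[of z] by linarith
  next
    case 3
    then obtain z where "z \<in> lattice_box m" "v $ i - z $ i \<le> \<delta> k" using assms(4)[of k] by (auto simp: c)
    then show ?thesis using 3 s b[OF assms(1)] b[of z] by linarith
  qed
qed

lemma extensor_lattice_box:
  assumes r: "2 \<le> r" "int CARD('n) \<le> r" and m: "0 \<le> m"
  shows "extensor TYPE('x::{metric_space,second_countable_topology})
    (realization_carrier (VR_simplices (lattice_box m :: (int ^ 'n) set) manhattan r))"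
proof -
  interpret rips manhattan r using r by (intro rips_manhattan) simp
  show ?thesis
  proof (rule extensor_of_vertex_order[where lt = below])
    have "0 \<in> lattice_box m" using m by (simp add: lattice_box_def)
    then show "lattice_box m \<noteq> {}" by blast
    fix v assume v: "v \<in> lattice_box m" and "\<exists>z\<in>lattice_box m. below z v"
    then obtain z where z: "z \<in> lattice_box m" "below z v" by blast
    let ?N = "{z\<in>lattice_box m. below z v \<and> manhattan v z \<le> r}"
    \<comment> \<open>\<open>Y\<close> must serve all cliques of lower neighbours at once. The box
      condition is imposed here because \<open>v\<close> may lie near the boundary.\<close>
    define Y where "Y = {y\<in>lattice_box m. \<exists>\<delta>\<in>moves r. lexpos \<delta> \<and> (\<forall>k. coord y k = coord v k - \<delta> k)}"
    have YI: "shift v \<delta> \<in> Y" if "\<delta> \<in> moves r" "lexpos \<delta>" "\<And>k. CARD('n) \<le> k \<Longrightarrow> \<delta> k = 0"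
      "shift v \<delta> \<in> lattice_box m" for \<delta>
      unfolding Y_def using that coord_shift[OF that(3)] by (intro CollectI conjI bexI[of _ \<delta>]) auto
    have "y \<in> ?N" if y: "y \<in> Y" for y
    proof -
      obtain \<delta> where \<delta>: "\<delta> \<in> moves r" "lexpos \<delta>" "\<And>k. coord y k = coord v k - \<delta> k" "y \<in> lattice_box m"
        using y unfolding Y_def by blast
      then show ?thesis using moves_len[OF r(1) \<delta>(1)] by (simp add: below_def manhattan_eq)
    qed
    moreover have "manhattan x y \<le> r" if xy: "x \<in> Y" "y \<in> Y" for x y
    proof -
      obtain \<delta> \<epsilon> where "\<delta> \<in> moves r" "\<And>k. coord x k = coord v k - \<delta> k"
        "\<epsilon> \<in> moves r" "\<And>k. coord y k = coord v k - \<epsilon> k"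
        using xy unfolding Y_def by blast
      then show ?thesis using moves_close[OF r(1), of \<epsilon> \<delta>] by (simp add: manhattan_eq)
    qed
    moreover have "Y \<noteq> {}"
    proof -
      \<comment> \<open>One step from \<open>v\<close> towards \<open>z\<close>, in a coordinate
        where \<open>v\<close> is larger, stays in the box.\<close>
      obtain k where k: "k < 5" "0 < coord v k - coord z k"
        using lexpos_ex z(2) unfolding below_def by blast
      then have kn: "k < CARD('n)" by (simp add: coord_def split: if_splits)
      have "shift v ((\<lambda>_. 0)(k := 1)) \<in> Y"
      proof (rule YI)
        show "(\<lambda>_. 0)(k := 1) \<in> moves r" using moves_unit[OF r(1) k(1)] kn r(2) by simp
        show "lexpos ((\<lambda>_. 0)(k := 1))" by (rule lexpos_upd[OF k(1)])
        show "shift v ((\<lambda>_. 0)(k := 1)) \<in> lattice_box m"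
        proof (rule shift_in_lattice_box[OF v])
          show "\<exists>z\<in>lattice_box m. ((\<lambda>_. 0)(k := 1)) l \<le> coord v l - coord z l"
            if "0 < ((\<lambda>_. 0 :: int)(k := 1)) l" for l
          proof -
            have "l = k" using that by (simp split: if_splits)
            then show ?thesis using k(2) z(1) by (intro bexI[of _ z]) auto
          qed
        qed (use kn in \<open>auto split: if_splits\<close>)
      qed (use kn in auto)
      then show ?thesis by blast
    qed
    moreover have "\<exists>y\<in>Y. \<forall>z\<in>\<sigma>. manhattan y z \<le> r" if \<sigma>: "\<sigma> \<in> VR ?N" for \<sigma>
    proof -
      define S where "S = (\<lambda>z k. coord v k - coord z k) ` \<sigma>"
      have \<sigma>N: "z \<in> lattice_box m" "below z v" "manhattan v z \<le> r" if "z \<in> \<sigma>" for z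
        using \<sigma> that by (auto simp: VR_simplices_def)
      interpret heavy S r
      proof
        show "w \<in> S \<Longrightarrow> len w \<le> r" for w using \<sigma>N(3) by (auto simp: S_def manhattan_eq)
        fix x y assume "x \<in> S" "y \<in> S"
        then obtain a b where ab: "a \<in> \<sigma>" "b \<in> \<sigma>" "x = (\<lambda>k. coord v k - coord a k)"
          "y = (\<lambda>k. coord v k - coord b k)" by (auto simp: S_def)
        then have "manhattan b a \<le> r" using \<sigma> by (auto simp: VR_simplices_def)
        then have "len (\<lambda>k. x k - y k) \<le> r" using ab by (simp add: manhattan_eq)
        then show "len x + len y - r \<le> 2 * overlaps x y" by (simp add: len_diff)
      qed
      have zero: "w k = 0" if "w \<in> S" "CARD('n) \<le> k" for w k
        using that by (auto simp: S_def coord_def)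
      have "\<exists>\<delta>\<in>moves r. lexpos \<delta> \<and> in_hull \<delta> \<and> admissible \<delta>"
      proof (rule exists_admissible[OF r(1)])
        show "S \<noteq> {}" using \<sigma> by (auto simp: S_def VR_simplices_def)
        show "w \<in> S \<Longrightarrow> lexpos w" for w using \<sigma>N(2) by (auto simp: S_def below_def)
        show "w i = 0" if "w \<in> S" "r \<le> int i" for w i using zero[OF that(1)] that(2) r(2) by simp
      qed
      then obtain \<delta> where \<delta>: "\<delta> \<in> moves r" "lexpos \<delta>" "in_hull \<delta>" "admissible \<delta>" by blast
      \<comment> \<open>Coordinates beyond the dimension vanish on \<open>S\<close>, and
        \<open>in_hull\<close> keeps \<delta> within the range of \<open>S\<close>.\<close>
      have \<delta>0: "\<delta> k = 0" if "CARD('n) \<le> k" for k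
        using \<delta>(3) zero[OF _ that] unfolding in_hull_def by (metis linorder_neqE not_le)
      have "shift v \<delta> \<in> lattice_box m"
      proof (rule shift_in_lattice_box[OF v \<delta>0])
        show "\<exists>z\<in>lattice_box m. \<delta> k \<le> coord v k - coord z k" if pos: "0 < \<delta> k" for k
        proof -
          obtain w where "w \<in> S" "\<delta> k \<le> w k" using \<delta>(3) pos unfolding in_hull_def by blast
          then show ?thesis using \<sigma>N(1) unfolding S_def by auto
        qed
        show "\<exists>z\<in>lattice_box m. coord v k - coord z k \<le> \<delta> k" if neg: "\<delta> k < 0" for k
        proof -
          obtain w where "w \<in> S" "w k \<le> \<delta> k" using \<delta>(3) neg unfolding in_hull_def by blast
          then show ?thesis using \<sigma>N(1) unfolding S_def by auto
        qed
      qed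
      then have "shift v \<delta> \<in> Y" using YI[OF \<delta>(1,2) \<delta>0] by blast
      moreover have "manhattan (shift v \<delta>) z \<le> r" if "z \<in> \<sigma>" for z
      proof -
        have "(\<lambda>k. coord v k - coord z k) \<in> S" using that by (auto simp: S_def)
        then have "len (\<lambda>k. (coord v k - coord z k) - \<delta> k) \<le> r"
          by (rule bspec[OF \<delta>(4)[unfolded admissible_def]])
        moreover have "(\<lambda>k. coord (shift v \<delta>) k - coord z k) = (\<lambda>k. (coord v k - coord z k) - \<delta> k)"
          by (simp add: coord_shift[OF \<delta>0] fun_eq_iff)
        ultimately show ?thesis unfolding manhattan_eq by simp
      qed
      ultimately show ?thesis by blast
    qed
    ultimately show "\<exists>Y\<subseteq>?N. Y \<noteq> {} \<and> (\<forall>x\<in>Y. \<forall>y\<in>Y. manhattan x y \<le> r) \<and>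
        (\<forall>\<sigma>\<in>VR ?N. \<exists>y\<in>Y. \<forall>z\<in>\<sigma>. manhattan y z \<le> r)"
      by (intro exI[of _ Y]) blast
  qed (rule finite_lattice_box transp_below asymp_below totalp_below)+
qed

end

theorem theorem3p12:
  fixes r :: int
  assumes "2 \<le> CARD('n::finite)" and "CARD('n) \<le> 5" and "int CARD('n) \<le> r"
  shows "contractible_space
           (realization (VR_simplices (UNIV :: (int ^ 'n) set) manhattan r))"
proof -
  obtain e :: "nat \<Rightarrow> 'n" where "bij_betw e {..<CARD('n)} UNIV"
    using ex_bij_betw_nat_finite[of "UNIV :: 'n set"] by (auto simp: atLeast0LessThan)
  then interpret enumerated e using assms(2) by unfold_locales
  let ?K = "VR_simplices (UNIV :: (int ^ 'n) set) manhattan r"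
  let ?L = "\<lambda>n. VR_simplices (lattice_box (int n) :: (int ^ 'n) set) manhattan r"
  show ?thesis
  proof (rule contractible_exhaustion[where L = ?L])
    show "abstract_complex ?K" by (rule abstract_complex_VR)
    show "finite (?L n)" for n by (rule finite_VR[OF finite_lattice_box])
    show "?L n \<subseteq> ?K" for n by (auto simp: VR_simplices_def)
    have "lattice_box (int n) \<subseteq> (lattice_box (int (Suc n)) :: (int ^ 'n) set)" for n
      unfolding lattice_box_def by (auto intro: order_trans)
    then show "?L n \<subseteq> ?L (Suc n)" for n unfolding VR_simplices_def by blast
    show "extensor TYPE(real \<times> (int ^ 'n \<Rightarrow> real)) (realization_carrier (?L n))" for n
      using assms by (intro extensor_lattice_box) auto
    fix v :: "int ^ 'n"
    \<comment> \<open>The sum bounds every coordinate of \<open>v\<close>, and a neighbour differs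
      from \<open>v\<close> by at most \<open>r\<close> in each coordinate.\<close>
    define n where "n = nat (r + (\<Sum>i\<in>UNIV. \<bar>v $ i\<bar>))"
    have "\<bar>z $ i\<bar> \<le> int n" if "manhattan v z \<le> r" for z i
    proof -
      have "\<bar>v $ i\<bar> \<le> (\<Sum>i\<in>UNIV. \<bar>v $ i\<bar>)"
        by (rule member_le_sum[of i UNIV "\<lambda>i. \<bar>v $ i\<bar>"]) auto
      then show ?thesis using component_le_manhattan[of v i z] that unfolding n_def by linarith
    qed
    then have "\<forall>\<sigma>\<in>?K. v \<in> \<sigma> \<longrightarrow> \<sigma> \<in> ?L n"
      unfolding VR_simplices_def lattice_box_def by blast
    then show "\<exists>n. \<forall>\<sigma>\<in>?K. v \<in> \<sigma> \<longrightarrow> \<sigma> \<in> ?L n" by blast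
  qed
qed

end
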